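(* Let $n\ge1$ and let $\widehat{\Pi_n^w}=\Pi_n^w\cup\{\hat 1\}$ be the poset of weighted partitions of $\{1,\dots,n\}$ with a maximum element $\hat 1$ adjoined. Define an edge labeling $\lambda$ of $\widehat{\Pi_n^w}$ with values in the poset $\Lambda_n$ (defined in the context) as follows. If $x\lessdot y$ in $\Pi_n^w$, then $y$ is obtained from $x$ by merging two blocks $A$ and $B$ of $x$, with $\min A<\min B$ and respective weights $w_A,w_B$, into the block $A\cup B$ with weight $u+w_A+w_B$, where $u\in\{0,1\}$; set $\lambda(x\lessdot y)=(\min A,\min B)^u$. For $i=0,\dots,n-1$ set $\lambda([n]^i\lessdot\hat 1)=(1,n+1)^0$. Then $\lambda$ is an EL-labeling of $\widehat{\Pi_n^w}$.
   Context: Let $[n]=\{1,\dots,n\}$. A weighted partition of $[n]$ is a set $\{B_1^{v_1},\dots,B_t^{v_t}\}$ where $\{B_1,\dots,B_t\}$ is a partition of $[n]$ and $v_i\in\{0,1,\dots,|B_i|-1\}$ for all $i$ ($v_i$ is the weight of $B_i$). The poset $\Pi_n^w$ is the set of weighted partitions of $[n]$ ordered by: $\{A_1^{w_1},\dots,A_s^{w_s}\}\le\{B_1^{v_1},\dots,B_t^{v_t}\}$ iff (a) $\{A_1,\dots,A_s\}$ refines $\{B_1,\dots,B_t\}$, and (b) whenever $B_k=A_{i_1}\cup\cdots\cup A_{i_l}$, then $v_k-(w_{i_1}+\cdots+w_{i_l})\in\{0,1,\dots,l-1\}$. Its minimum element is $\hat 0=\{\{1\}^0,\dots,\{n\}^0\}$,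 and its maximal elements are $[n]^i:=\{[n]^i\}$, $0\le i\le n-1$. $\widehat{\Pi_n^w}$ is obtained by adjoining an element $\hat 1$ above all others. The label poset: for $a\in[n]$ let $\Gamma_a=\{(a,b)^u: a<b\le n+1,\ u\in\{0,1\}\}$, partially ordered by $(a,b)^u\le(a,c)^v$ iff $b\le c$ and $u\le v$. Let $\Lambda_n=\Gamma_1\oplus\Gamma_2\oplus\cdots\oplus\Gamma_n$ be the ordinal sum (every element of $\Gamma_a$ is below every element of $\Gamma_{a'}$ when $a<a'$). An edge labeling of a bounded poset $P$ is a map from the set of covering relations $x\lessdot y$ of $P$ to a poset $\Lambda$. It assigns to a maximal chain $x_0\lessdot x_1\lessdot\cdots\lessdot x_t$ of a closed interval $[x,y]$ ($x_0=x$, $x_t=y$) the label word $\lambda(x_0,x_1)\lambda(x_1,x_2)\cdots\lambda(x_{t-1},x_t)$. The chain is increasing if its label word is strictly increasing: $\lambda(x_0,x_1)<\lambda(x_1,x_2)<\cdots<\lambda(x_{t-1},x_t)$. Maximal chains of $[x,y]$ are partially ordered by the lexicographic order on their label words. The edge labeling is an EL-labeling if in each closed interval $[x,y]$ of $P$ there is a unique increasing maximal chain, and this chain lexicographically precedes all other maximal chains of $[x,y]$. *)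

theory Defs
  imports Main "HOL-Library.Disjoint_Sets"
begin

section \<open>Edge labelings of bounded posets\<close>

text \<open>A poset is a carrier set together with its reflexive order relation.\<close>

definition strict :: "'a rel \<Rightarrow> 'a rel" where
  "strict r = r - Id"

definition covers :: "'a rel \<Rightarrow> 'a rel" where
  "covers r = {(x, y). (x, y) \<in> strict r \<and> (\<nexists>z. (x, z) \<in> strict r \<and> (z, y) \<in> strict r)}"

definition bounded_poset :: "'a set \<Rightarrow> 'a rel \<Rightarrow> bool" where
  "bounded_poset P r \<longleftrightarrow> partial_order_on P r \<and>
     (\<exists>b\<in>P. \<forall>x\<in>P. (b, x) \<in> r) \<and> (\<exists>t\<in>P. \<forall>x\<in>P. (x, t) \<in> r)"

definition edge_labeling ::
  "'a set \<Rightarrow> 'a rel \<Rightarrow> 'l set \<Rightarrow> 'l rel \<Rightarrow> ('a \<Rightarrow> 'a \<Rightarrow> 'l) \<Rightarrow> bool" where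
  "edge_labeling P r L s lab \<longleftrightarrow> bounded_poset P r \<and> partial_order_on L s \<and>
     (\<forall>x y. (x, y) \<in> covers r \<longrightarrow> lab x y \<in> L)"

text \<open>The maximal chains of the closed interval from x to y, listed from bottom to top;
  for x = y this is the one-element list, whose label word is empty.\<close>

definition max_chains :: "'a rel \<Rightarrow> 'a \<Rightarrow> 'a \<Rightarrow> 'a list set" where
  "max_chains r x y =
     {c. c \<noteq> [] \<and> hd c = x \<and> last c = y \<and> successively (\<lambda>a b. (a, b) \<in> covers r) c}"

definition label_word :: "('a \<Rightarrow> 'a \<Rightarrow> 'l) \<Rightarrow> 'a list \<Rightarrow> 'l list" where
  "label_word lab c = map (\<lambda>(a, b). lab a b) (zip c (tl c))"

definition increasing_chain :: "'l rel \<Rightarrow> ('a \<Rightarrow> 'a \<Rightarrow> 'l) \<Rightarrow> 'a list \<Rightarrow> bool" where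
  "increasing_chain s lab c \<longleftrightarrow> successively (\<lambda>p q. (p, q) \<in> strict s) (label_word lab c)"

text \<open>The labels are only partially ordered: one word lexicographically precedes another if it is
  a proper prefix, or if at the first position where they differ its letter is strictly
  smaller (and in particular comparable).\<close>

definition EL_labeling ::
  "'a set \<Rightarrow> 'a rel \<Rightarrow> 'l set \<Rightarrow> 'l rel \<Rightarrow> ('a \<Rightarrow> 'a \<Rightarrow> 'l) \<Rightarrow> bool" where
  "EL_labeling P r L s lab \<longleftrightarrow> edge_labeling P r L s lab \<and>
     (\<forall>x y. (x, y) \<in> r \<longrightarrow>
        (\<exists>!c. c \<in> max_chains r x y \<and> increasing_chain s lab c) \<and>
        (\<forall>c\<in>max_chains r x y. increasing_chain s lab c \<longrightarrow>
           (\<forall>c'\<in>max_chains r x y. c' \<noteq> c \<longrightarrow>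
              (label_word lab c, label_word lab c') \<in> lexord (strict s))))"


section \<open>Weighted partitions\<close>

text \<open>The weighted block consisting of B with weight v is the pair (B, v). Injectivity of
  the first projection says that every block carries exactly one weight.\<close>

type_synonym wpart = "(nat set \<times> nat) set"

definition wparts :: "nat \<Rightarrow> wpart set" where
  "wparts n = {x. partition_on {1..n} (fst ` x) \<and> inj_on fst x \<and> (\<forall>(B, v)\<in>x. v < card B)}"

text \<open>The weight difference is taken in the integers, as natural subtraction truncates.\<close>

definition wparts_le :: "nat \<Rightarrow> wpart rel" where
  "wparts_le n = {(x, y). x \<in> wparts n \<and> y \<in> wparts n \<and>
     refines {1..n} (fst ` x) (fst ` y) \<and>
     (\<forall>(B, v)\<in>y. \<forall>S\<subseteq>x. B = \<Union> (fst ` S) \<longrightarrow>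
        int v - (\<Sum>(A, w)\<in>S. int w) \<in> {0..int (card S) - 1})}"

text \<open>The adjoined maximum is \<^const>\<open>None\<close>.\<close>

definition wparts_hat :: "nat \<Rightarrow> wpart option set" where
  "wparts_hat n = insert None (Some ` wparts n)"

definition wparts_hat_le :: "nat \<Rightarrow> wpart option rel" where
  "wparts_hat_le n = {(Some x, Some y) |x y. (x, y) \<in> wparts_le n} \<union> wparts_hat n \<times> {None}"


section \<open>The label poset and the labeling\<close>

text \<open>The label with entries a, b and exponent u is the triple (a, b, u).\<close>

type_synonym label = "nat \<times> nat \<times> nat"

definition Gamma :: "nat \<Rightarrow> nat \<Rightarrow> label set" where
  "Gamma n a = {(a, b, u) |b u. a < b \<and> b \<le> n + 1 \<and> u \<in> {0, 1}}"

definition Gamma_le :: "nat \<Rightarrow> nat \<Rightarrow> label rel" where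
  "Gamma_le n a = {((a, b, u), (a, c, v)) |b u c v.
     (a, b, u) \<in> Gamma n a \<and> (a, c, v) \<in> Gamma n a \<and> b \<le> c \<and> u \<le> v}"

definition Lambda :: "nat \<Rightarrow> label set" where
  "Lambda n = (\<Union>a\<in>{1..n}. Gamma n a)"

definition Lambda_le :: "nat \<Rightarrow> label rel" where
  "Lambda_le n = (\<Union>a\<in>{1..n}. Gamma_le n a) \<union>
     (\<Union>a\<in>{1..n}. \<Union>a'\<in>{a<..n}. Gamma n a \<times> Gamma n a')"

definition merges ::
  "wpart \<Rightarrow> nat set \<Rightarrow> nat \<Rightarrow> nat set \<Rightarrow> nat \<Rightarrow> nat \<Rightarrow> wpart \<Rightarrow> bool" where
  "merges x A wA B wB u y \<longleftrightarrow> (A, wA) \<in> x \<and> (B, wB) \<in> x \<and> Min A < Min B \<and> u \<in> {0, 1} \<and>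
     y = (x - {(A, wA), (B, wB)}) \<union> {(A \<union> B, u + wA + wB)}"

text \<open>Only the values on covering relations matter. If y covers x in the poset of weighted
  partitions, the merged blocks and u are determined by x and y, so the description
  is proper there.\<close>

fun wlabel :: "nat \<Rightarrow> wpart option \<Rightarrow> wpart option \<Rightarrow> label" where
  "wlabel n (Some x) (Some y) =
     (THE l. \<exists>A wA B wB u. merges x A wA B wB u y \<and> l = (Min A, Min B, u))"
| "wlabel n (Some x) None =
     (if \<exists>i<n. x = {({1..n}, i)} then (1, n + 1, 0) else undefined)"
| "wlabel n None q = undefined"

end

theory Submission
  imports Defs
begin

text \<open>For \<open>x < y\<close>, a single cover of \<open>x\<close> below \<open>y\<close> has the least label. By induction on the number
  of blocks, it suffices that a step from \<open>x\<close> to a cover \<open>z\<close> below \<open>y\<close>, followed by the least-label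
  step from \<open>z\<close> towards \<open>y\<close>, is increasing precisely if the step from \<open>x\<close> is itself the least one:
  then following least labels is the only increasing chain, and it wins at the first place where
  another chain deviates. The adjoined maximum behaves like a top block \<open>[n]\<close> without constraint on
  its weight.\<close>

text \<open>\<open>Lambda\<close> is not a chain: for equal first entries, a smaller second entry
  may come with a larger exponent, so a least label has to minimise both at once. This is possible
  because whether increment \<open>u\<close> is allowed when merging two blocks of \<open>x\<close>
  inside a block \<open>C\<close> of \<open>y\<close> depends on \<open>C\<close> alone. The weights
  that \<open>C\<close> can carry form an interval; a merge with increment 0 removes its largest
  element, one with increment 1 its smallest, and the weight of \<open>C\<close> in \<open>y\<close>
  has to survive. Hence the partner block and the exponent can be chosen independently. In an
  increasing chain each block of \<open>y\<close> is built up around its minimum, absorbing the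
  other pieces in the order of their minima, with all increments 0 before all increments 1; the
  number of ones is forced by the weight in \<open>y\<close>. Below the adjoined maximum no weight
  forces any ones, and the exponent 0 of its label (1, n+1, 0) rules them out.\<close>

section \<open>A local criterion for EL-labelings\<close>

lemma strict_iff: "(x, y) \<in> strict r \<longleftrightarrow> (x, y) \<in> r \<and> x \<noteq> y"
  by (auto simp: strict_def)

lemma coversD:
  assumes "(x, y) \<in> covers r"
  shows "(x, y) \<in> r" "x \<noteq> y"
  using assms by (auto simp: covers_def strict_iff)

lemma coversI:
  assumes "(x, y) \<in> r" "x \<noteq> y" "\<And>z. (x, z) \<in> strict r \<Longrightarrow> (z, y) \<in> strict r \<Longrightarrow> False"
  shows "(x, y) \<in> covers r"
  using assms by (auto simp: covers_def strict_iff)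

lemma max_chains_singleton:
  "x = y \<Longrightarrow> [x] \<in> max_chains r x y"
  by (simp add: max_chains_def)

lemma max_chains_Cons:
  assumes "(x, z) \<in> covers r" "c \<in> max_chains r z y"
  shows "x # c \<in> max_chains r x y"
  using assms by (cases c) (auto simp: max_chains_def)

lemma max_chains_imp_le:
  assumes "c \<in> max_chains r x y" "trans r" "(y, y) \<in> r"
  shows "(x, y) \<in> r"
  using assms(1)
proof (induction c arbitrary: x)
  case Nil
  then show ?case by (simp add: max_chains_def)
next
  case (Cons a c)
  show ?case
  proof (cases c)
    case Nil
    then show ?thesis using Cons.prems assms(3) by (auto simp: max_chains_def)
  next
    case (Cons b c')
    then have "c \<in> max_chains r b y" "(x, b) \<in> covers r"
      using Cons.prems by (auto simp: max_chains_def)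
    then show ?thesis using Cons.IH coversD(1) assms(2) by (metis transD)
  qed
qed

lemma max_chains_cases:
  assumes "c \<in> max_chains r x y"
  obtains "x = y" "c = [x]"
  | z c' where "c = x # c'" "(x, z) \<in> covers r" "c' \<in> max_chains r z y" "hd c' = z" "c' \<noteq> []"
proof (cases "tl c")
  case Nil
  then show ?thesis using assms that(1) by (cases c) (auto simp: max_chains_def)
next
  case (Cons z c'')
  then show ?thesis using assms that(2)[of "tl c" z]
    by (cases c) (auto simp: max_chains_def)
qed

lemma label_word_Cons:
  "c \<noteq> [] \<Longrightarrow> label_word lab (x # c) = lab x (hd c) # label_word lab c"
  by (cases c) (auto simp: label_word_def)

text \<open>Think of \<open>G x y z\<close> as: \<open>z\<close> is the first step of the increasing
  chain from \<open>x\<close> to \<open>y\<close>. Both global conditions reduce to two-step ones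
  because the tail of an increasing chain is again increasing, hence by induction the chosen one, so
  its first step is a \<open>G\<close>-step as well.\<close>

lemma EL_labelingI:
  fixes \<mu> :: "'a \<Rightarrow> nat" and G :: "'a \<Rightarrow> 'a \<Rightarrow> 'a \<Rightarrow> bool"
  assumes el: "edge_labeling P r L s lab"
    and rank: "\<And>x y. (x, y) \<in> covers r \<Longrightarrow> \<mu> y < \<mu> x"
    and ex: "\<And>x y. (x, y) \<in> r \<Longrightarrow> x \<noteq> y \<Longrightarrow> \<exists>z. G x y z"
    and G: "\<And>x y z. G x y z \<Longrightarrow> (x, y) \<in> r \<Longrightarrow> (x, z) \<in> covers r \<and> (z, y) \<in> r"
    and first: "\<And>x y z z'. G x y z \<Longrightarrow> (x, y) \<in> r \<Longrightarrow> (x, z') \<in> covers r \<Longrightarrow> (z', y) \<in> r \<Longrightarrow>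
      z' \<noteq> z \<Longrightarrow> (lab x z, lab x z') \<in> strict s"
    and incr: "\<And>x y z z' z''. G x y z \<Longrightarrow> (x, y) \<in> r \<Longrightarrow> (x, z') \<in> covers r \<Longrightarrow> (z', y) \<in> r \<Longrightarrow>
      G z' y z'' \<Longrightarrow> z' \<noteq> y \<Longrightarrow> (lab x z', lab z' z'') \<in> strict s \<longleftrightarrow> z' = z"
  shows "EL_labeling P r L s lab"
proof -
  have po: "partial_order_on P r"
    using el by (auto simp: edge_labeling_def bounded_poset_def)
  then have tr: "trans r" and an: "antisym r"
    by (auto simp: partial_order_on_def preorder_on_def)
  have rf: "(y, y) \<in> r" if "(x, y) \<in> r" for x y
    using po that by (auto simp: partial_order_on_def preorder_on_def refl_on_def)
  \<comment> \<open>The conjunct about \<open>hd (tl c)\<close> strengthens the induction: it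
    records that the increasing chain starts with a \<open>G\<close>-step, which is what
    \<open>incr\<close> speaks about one level further down.\<close>
  have main: "\<exists>c. c \<in> max_chains r x y \<and> increasing_chain s lab c \<and>
        (x \<noteq> y \<longrightarrow> G x y (hd (tl c))) \<and>
        (\<forall>c'\<in>max_chains r x y. c' \<noteq> c \<longrightarrow> \<not> increasing_chain s lab c' \<and>
           (label_word lab c, label_word lab c') \<in> lexord (strict s))"
    if "(x, y) \<in> r" for x y
    using that
  proof (induction "\<mu> x" arbitrary: x rule: less_induct)
    case less
    note yy = rf[OF less.prems]
    show ?case
    proof (cases "x = y")
      case True
      have "c' = [x]" if "c' \<in> max_chains r x y" for c'
        using that
      proof (cases rule: max_chains_cases)
        case (2 z c)
        then have "(z, y) \<in> r" "(x, z) \<in> r" "x \<noteq> z"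
          using max_chains_imp_le[OF _ tr yy] coversD[OF 2(2)] 2(3) by auto
        then show ?thesis using True an by (auto dest: antisymD)
      qed auto
      then show ?thesis using True
        by (intro exI[of _ "[x]"])
          (auto simp: max_chains_singleton increasing_chain_def label_word_def)
    next
      case False
      obtain z where z: "G x y z" using ex[OF less.prems False] by blast
      have cz: "(x, z) \<in> covers r" "(z, y) \<in> r" using G[OF z less.prems] by auto
      obtain c where c: "c \<in> max_chains r z y" "increasing_chain s lab c"
        "z \<noteq> y \<longrightarrow> G z y (hd (tl c))"
        "\<And>c'. c' \<in> max_chains r z y \<Longrightarrow> c' \<noteq> c \<Longrightarrow> \<not> increasing_chain s lab c' \<and>
           (label_word lab c, label_word lab c') \<in> lexord (strict s)"
        using less.hyps[OF rank[OF cz(1)] cz(2)] by blast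
      have hc: "c \<noteq> []" "hd c = z" "last c = y" using c(1) by (auto simp: max_chains_def)
      have step: "increasing_chain s lab (x # d) \<longleftrightarrow> increasing_chain s lab d \<and>
          (w \<noteq> y \<longrightarrow> (lab x w, lab w (hd (tl d))) \<in> strict s)"
        if d: "d \<in> max_chains r w y" for w d
        using d
      proof (cases rule: max_chains_cases)
        case 1
        then show ?thesis by (simp add: increasing_chain_def label_word_def)
      next
        case (2 w' d')
        have "w \<noteq> y"
          using 2 max_chains_imp_le[OF 2(3) tr yy] coversD[OF 2(2)] an
          by (metis antisymD)
        then show ?thesis using 2
          by (auto simp: increasing_chain_def label_word_Cons)
      qed
      have inc: "increasing_chain s lab (x # c)"
        using step[OF c(1)] c(2,3) incr[OF z less.prems cz] by blast
      have oth: "\<not> increasing_chain s lab c' \<and>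
           (label_word lab (x # c), label_word lab c') \<in> lexord (strict s)"
        if c': "c' \<in> max_chains r x y" "c' \<noteq> x # c" for c'
        using c'(1)
      proof (cases rule: max_chains_cases)
        case 1
        then show ?thesis using False by simp
      next
        case (2 w d)
        have wy: "(w, y) \<in> r" using max_chains_imp_le[OF 2(3) tr yy] .
        show ?thesis
        proof (cases "w = z")
          case True
          then have "\<not> increasing_chain s lab d \<and>
              (label_word lab c, label_word lab d) \<in> lexord (strict s)"
            using c(4)[of d] 2 c'(2) by auto
          then show ?thesis using 2 True hc step[OF 2(3)]
            by (auto simp: label_word_Cons)
        next
          case neq: False
          have lx: "(lab x z, lab x w) \<in> strict s" using first[OF z less.prems 2(2) wy neq] .
          \<comment> \<open>The tail of an increasing \<open>c'\<close> would be the unique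
            increasing chain above \<open>w\<close>, so the second step of \<open>c'\<close> would
            be a \<open>G\<close>-step and \<open>incr\<close> would force
            \<open>w = z\<close>.\<close>
          have "\<not> increasing_chain s lab c'"
          proof
            assume i: "increasing_chain s lab c'"
            then have i2: "increasing_chain s lab d" using step[OF 2(3)] 2(1) by simp
            \<comment> \<open>Otherwise \<open>z\<close> would lie strictly between \<open>x\<close>
              and its cover \<open>w\<close>.\<close>
            have wny: "w \<noteq> y"
            proof
              assume "w = y"
              then have "(x, z) \<in> strict r" "(z, w) \<in> strict r"
                using cz neq coversD[OF cz(1)] by (auto simp: strict_iff)
              then show False using 2(2) by (auto simp: covers_def)
            qed
            obtain e where e: "e \<in> max_chains r w y" "G w y (hd (tl e))"
              "\<And>c'. c' \<in> max_chains r w y \<Longrightarrow> c' \<noteq> e \<Longrightarrow> \<not> increasing_chain s lab c'"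
              using less.hyps[OF rank[OF 2(2)] wy] wny by blast
            have "d = e" using e(3)[OF 2(3)] i2 by blast
            then have "(lab x w, lab w (hd (tl e))) \<in> strict s"
              using i step[OF 2(3)] 2(1) wny by simp
            then show False using incr[OF z less.prems 2(2) wy e(2) wny] neq by simp
          qed
          then show ?thesis using 2 lx hc by (auto simp: label_word_Cons)
        qed
      qed
      show ?thesis
        using max_chains_Cons[OF cz(1) c(1)] inc oth z hc
        by (intro exI[of _ "x # c"]) auto
    qed
  qed
  show ?thesis
    unfolding EL_labeling_def
  proof (intro conjI allI impI el)
    fix x y assume xy: "(x, y) \<in> r"
    then obtain c where "c \<in> max_chains r x y" "increasing_chain s lab c"
      "\<forall>c'\<in>max_chains r x y. c' \<noteq> c \<longrightarrow> \<not> increasing_chain s lab c' \<and>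
           (label_word lab c, label_word lab c') \<in> lexord (strict s)"
      using main by blast
    then show "\<exists>!c. c \<in> max_chains r x y \<and> increasing_chain s lab c"
      "\<forall>c\<in>max_chains r x y. increasing_chain s lab c \<longrightarrow>
           (\<forall>c'\<in>max_chains r x y. c' \<noteq> c \<longrightarrow>
              (label_word lab c, label_word lab c') \<in> lexord (strict s))"
      by metis+
  qed
qed

section \<open>Weighted partitions\<close>

text \<open>Disjointness of the blocks and injectivity of \<open>fst\<close> are fused into one
  condition: weighted blocks that meet are equal, weights included. Nonempty blocks meet themselves,
  which recovers injectivity.\<close>

lemma wparts_iff:
  "x \<in> wparts n \<longleftrightarrow>
     (\<forall>p\<in>x. fst p \<noteq> {} \<and> fst p \<subseteq> {1..n} \<and> snd p < card (fst p)) \<and>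
     (\<forall>p\<in>x. \<forall>q\<in>x. fst p \<inter> fst q \<noteq> {} \<longrightarrow> p = q) \<and>
     (\<forall>i\<in>{1..n}. \<exists>p\<in>x. i \<in> fst p)"
proof (intro iffI conjI ballI impI)
  assume x: "x \<in> wparts n"
  then have P: "partition_on {1..n} (fst ` x)" and i: "inj_on fst x" and v: "\<forall>(B, v)\<in>x. v < card B"
    by (auto simp: wparts_def)
  show "p = q" if "p \<in> x" "q \<in> x" "fst p \<inter> fst q \<noteq> {}" for p q
    using disjointD[OF partition_onD2[OF P], of "fst p" "fst q"] that inj_onD[OF i] by blast
  show "fst p \<noteq> {}" if "p \<in> x" for p using partition_onD3[OF P] that by auto
  show "fst p \<subseteq> {1..n}" if "p \<in> x" for p using that unfolding partition_onD1[OF P] by blast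
  show "snd p < card (fst p)" if "p \<in> x" for p using v that by auto
  show "\<exists>p\<in>x. i \<in> fst p" if "i \<in> {1..n}" for i
    using that unfolding partition_onD1[OF P] by blast
next
  assume R: "(\<forall>p\<in>x. fst p \<noteq> {} \<and> fst p \<subseteq> {1..n} \<and> snd p < card (fst p)) \<and>
     (\<forall>p\<in>x. \<forall>q\<in>x. fst p \<inter> fst q \<noteq> {} \<longrightarrow> p = q) \<and>
     (\<forall>i\<in>{1..n}. \<exists>p\<in>x. i \<in> fst p)"
  then have a: "\<And>p. p \<in> x \<Longrightarrow> fst p \<noteq> {} \<and> fst p \<subseteq> {1..n} \<and> snd p < card (fst p)"
    and b: "\<And>p q. p \<in> x \<Longrightarrow> q \<in> x \<Longrightarrow> fst p \<inter> fst q \<noteq> {} \<Longrightarrow> p = q"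
    and c: "\<And>i. i \<in> {1..n} \<Longrightarrow> \<exists>p\<in>x. i \<in> fst p"
    by blast+
  have "inj_on fst x" using a b by (intro inj_onI) (metis Int_absorb)
  moreover have "partition_on {1..n} (fst ` x)"
  proof (rule partition_onI)
    show "\<Union> (fst ` x) = {1..n}"
    proof
      show "\<Union> (fst ` x) \<subseteq> {1..n}" using a by blast
      show "{1..n} \<subseteq> \<Union> (fst ` x)" using c by blast
    qed
    show "disjnt p q" if "p \<in> fst ` x" "q \<in> fst ` x" "p \<noteq> q" for p q
      using b that unfolding disjnt_def by blast
    show "{} \<notin> fst ` x" using a by blast
  qed
  moreover have "\<forall>(B, v)\<in>x. v < card B" using a by auto
  ultimately show "x \<in> wparts n" by (simp add: wparts_def)
qed

lemma wpartsD:
  assumes "x \<in> wparts n" "(A, w) \<in> x"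
  shows "A \<noteq> {}" "A \<subseteq> {1..n}" "finite A" "w < card A" "Min A \<in> A"
proof -
  have "\<forall>p\<in>x. fst p \<noteq> {} \<and> fst p \<subseteq> {1..n} \<and> snd p < card (fst p)"
    using assms(1) unfolding wparts_iff by (elim conjE)
  from bspec[OF this assms(2)] show *: "A \<noteq> {}" "A \<subseteq> {1..n}" "w < card A" by auto
  show "finite A" using *(2) by (rule finite_subset) simp
  then show "Min A \<in> A" using * by simp
qed

lemma wparts_eq:
  assumes "x \<in> wparts n" "(A, w) \<in> x" "(B, v) \<in> x" "i \<in> A" "i \<in> B"
  shows "A = B" "w = v"
proof -
  have "\<forall>p\<in>x. \<forall>q\<in>x. fst p \<inter> fst q \<noteq> {} \<longrightarrow> p = q"
    using assms(1) unfolding wparts_iff by (elim conjE)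
  from this[rule_format, OF assms(2,3)] show "A = B" "w = v" using assms(4,5) by auto
qed

lemma wparts_ex:
  assumes "x \<in> wparts n" "i \<in> {1..n}"
  obtains A w where "(A, w) \<in> x" "i \<in> A"
proof -
  have "\<forall>i\<in>{1..n}. \<exists>p\<in>x. i \<in> fst p" using assms(1) unfolding wparts_iff by (elim conjE)
  then obtain p where "p \<in> x" "i \<in> fst p" using assms(2) by blast
  then show ?thesis using that[of "fst p" "snd p"] by simp
qed

lemma finite_wparts:
  assumes "x \<in> wparts n"
  shows "finite x"
proof -
  have "partition_on {1..n} (fst ` x)" "inj_on fst x" using assms by (auto simp: wparts_def)
  then show ?thesis using finite_elements finite_imageD by blast
qed

section \<open>The order in terms of intervals of available weights\<close>

definition below :: "wpart \<Rightarrow> nat set \<Rightarrow> wpart" where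
  "below x D = {p \<in> x. fst p \<subseteq> D}"

text \<open>If \<open>D\<close> is a union of blocks of \<open>x\<close>, the weights that \<open>D\<close> can carry above \<open>x\<close> are those in
  \<open>{lo x D..<hi x D}\<close>; the order becomes transparent as both bounds are additive.\<close>

definition lo :: "wpart \<Rightarrow> nat set \<Rightarrow> nat" where
  "lo x D = (\<Sum>p\<in>below x D. snd p)"

definition hi :: "wpart \<Rightarrow> nat set \<Rightarrow> nat" where
  "hi x D = (\<Sum>p\<in>below x D. Suc (snd p))"

lemma hi_eq: "hi x D = lo x D + card (below x D)"
  by (simp add: hi_def lo_def sum_Suc)

text \<open>Once \<open>x\<close> refines \<open>y\<close>, the only set of blocks of
  \<open>x\<close> with union \<open>C\<close> is \<open>below x C\<close>, so the quantifier over
  \<open>S\<close> collapses. The integer condition on the weight difference then says that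
  \<open>v\<close> lies in the interval from \<open>lo x C\<close> to
  \<open>lo x C + card (below x C)\<close>, right end excluded.\<close>

lemma wparts_le_iff:
  "(x, y) \<in> wparts_le n \<longleftrightarrow> x \<in> wparts n \<and> y \<in> wparts n \<and>
     (\<forall>A w. (A, w) \<in> x \<longrightarrow> (\<exists>C v. (C, v) \<in> y \<and> A \<subseteq> C)) \<and>
     (\<forall>C v. (C, v) \<in> y \<longrightarrow> lo x C \<le> v \<and> v < hi x C)"
proof (cases "x \<in> wparts n \<and> y \<in> wparts n \<and> (\<forall>A w. (A, w) \<in> x \<longrightarrow> (\<exists>C v. (C, v) \<in> y \<and> A \<subseteq> C))")
  case True
  then have x: "x \<in> wparts n" and y: "y \<in> wparts n" and r: "\<forall>A w. (A, w) \<in> x \<longrightarrow> (\<exists>C v. (C, v) \<in> y \<and> A \<subseteq> C)"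
    by auto
  have ref: "refines {1..n} (fst ` x) (fst ` y)"
  proof -
    have "partition_on {1..n} (fst ` x)" "partition_on {1..n} (fst ` y)"
      using x y by (simp_all add: wparts_def)
    moreover have "\<forall>A\<in>fst ` x. \<exists>C\<in>fst ` y. A \<subseteq> C"
    proof
      fix A assume "A \<in> fst ` x"
      then obtain w where "(A, w) \<in> x" by auto
      then obtain C v where "(C, v) \<in> y" "A \<subseteq> C" using r by blast
      then show "\<exists>C\<in>fst ` y. A \<subseteq> C" by force
    qed
    ultimately show ?thesis by (simp add: refines_def)
  qed
  \<comment> \<open>A block of \<open>x\<close> inside \<open>C\<close> meets some member of
    \<open>S\<close>, and blocks of \<open>x\<close> that meet are equal; so \<open>S\<close> is
    forced.\<close>
  have S: "S \<subseteq> x \<and> C = \<Union> (fst ` S) \<longleftrightarrow> S = below x C" if C: "(C, v) \<in> y" for C v S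
  proof
    assume a: "S \<subseteq> x \<and> C = \<Union> (fst ` S)"
    have "below x C \<subseteq> S"
    proof (clarify)
      fix A w assume "(A, w) \<in> below x C"
      then have A: "(A, w) \<in> x" "A \<subseteq> C" by (auto simp: below_def)
      then obtain i where i: "i \<in> A" using wpartsD(1)[OF x] by blast
      then have "i \<in> \<Union> (fst ` S)" using A a by blast
      then obtain B u where B: "(B, u) \<in> S" "i \<in> B" by auto
      then have "(B, u) \<in> x" using a by blast
      from wparts_eq[OF x A(1) this i B(2)] show "(A, w) \<in> S" using B(1) by simp
    qed
    moreover have "S \<subseteq> below x C"
    proof
      fix p assume "p \<in> S"
      then have "p \<in> x" "fst p \<subseteq> \<Union> (fst ` S)" using a by blast+
      then show "p \<in> below x C" using a by (simp add: below_def)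
    qed
    ultimately show "S = below x C" by blast
  next
    assume S: "S = below x C"
    have "C \<subseteq> \<Union> (fst ` S)"
    proof
      fix i assume i: "i \<in> C"
      then have "i \<in> {1..n}" using wpartsD(2)[OF y C] by blast
      then obtain A w where A: "(A, w) \<in> x" "i \<in> A" using wparts_ex[OF x] by blast
      then obtain C' v' where C': "(C', v') \<in> y" "A \<subseteq> C'" using r by blast
      then have "i \<in> C'" using A by blast
      from wparts_eq(1)[OF y C C'(1) i this] have "(A, w) \<in> S" using C' A S by (simp add: below_def)
      then show "i \<in> \<Union> (fst ` S)" using A(2) by force
    qed
    moreover have "\<Union> (fst ` S) \<subseteq> C" "S \<subseteq> x" unfolding S below_def by blast+
    ultimately show "S \<subseteq> x \<and> C = \<Union> (fst ` S)" by blast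
  qed
  have *: "(\<forall>S\<subseteq>x. C = \<Union> (fst ` S) \<longrightarrow>
        int v - (\<Sum>(A, w)\<in>S. int w) \<in> {0..int (card S) - 1}) \<longleftrightarrow> lo x C \<le> v \<and> v < hi x C"
    if C: "(C, v) \<in> y" for C v
  proof -
    have "(\<Sum>(A, w)\<in>below x C. int w) = int (lo x C)"
      by (simp add: lo_def case_prod_unfold)
    then have "int v - (\<Sum>(A, w)\<in>below x C. int w) \<in> {0..int (card (below x C)) - 1} \<longleftrightarrow>
        lo x C \<le> v \<and> v < hi x C"
      by (auto simp: hi_eq)
    moreover have "(\<forall>S\<subseteq>x. C = \<Union> (fst ` S) \<longrightarrow> Q S) \<longleftrightarrow> Q (below x C)" for Q
    proof -
      have "(\<forall>S\<subseteq>x. C = \<Union> (fst ` S) \<longrightarrow> Q S) \<longleftrightarrow> (\<forall>S. S = below x C \<longrightarrow> Q S)"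
        by (simp only: S[OF C, symmetric] imp_conjL)
      then show ?thesis by simp
    qed
    ultimately show ?thesis by (simp only:)
  qed
  then have "(\<forall>(C, v)\<in>y. \<forall>S\<subseteq>x. C = \<Union> (fst ` S) \<longrightarrow>
        int v - (\<Sum>(A, w)\<in>S. int w) \<in> {0..int (card S) - 1}) \<longleftrightarrow>
     (\<forall>C v. (C, v) \<in> y \<longrightarrow> lo x C \<le> v \<and> v < hi x C)"
    using * by (simp add: Ball_def)
  then show ?thesis using x y r ref unfolding wparts_le_def by simp
next
  case False
  have "\<forall>A w. (A, w) \<in> x \<longrightarrow> (\<exists>C v. (C, v) \<in> y \<and> A \<subseteq> C)" if "(x, y) \<in> wparts_le n"
  proof -
    have *: "\<forall>A\<in>fst ` x. \<exists>C\<in>fst ` y. A \<subseteq> C"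
      using that by (simp add: wparts_le_def refines_def)
    show ?thesis
    proof (intro allI impI)
      fix A w assume "(A, w) \<in> x"
      then have "A \<in> fst ` x" by force
      then obtain C where "C \<in> fst ` y" "A \<subseteq> C" using * by blast
      then show "\<exists>C v. (C, v) \<in> y \<and> A \<subseteq> C" by force
    qed
  qed
  moreover have "x \<in> wparts n \<and> y \<in> wparts n" if "(x, y) \<in> wparts_le n"
    using that by (simp add: wparts_le_def)
  ultimately have "(x, y) \<notin> wparts_le n" using False by metis
  then show ?thesis using False by (intro iffI) (rule notE, assumption+, elim conjE, rule notE, assumption, intro conjI)
qed

lemma wparts_leD:
  assumes "(x, y) \<in> wparts_le n"
  shows "x \<in> wparts n" "y \<in> wparts n"
    "\<And>A w. (A, w) \<in> x \<Longrightarrow> \<exists>C v. (C, v) \<in> y \<and> A \<subseteq> C"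
    "\<And>C v. (C, v) \<in> y \<Longrightarrow> lo x C \<le> v \<and> v < hi x C"
proof -
  have *: "x \<in> wparts n \<and> y \<in> wparts n \<and>
     (\<forall>A w. (A, w) \<in> x \<longrightarrow> (\<exists>C v. (C, v) \<in> y \<and> A \<subseteq> C)) \<and>
     (\<forall>C v. (C, v) \<in> y \<longrightarrow> lo x C \<le> v \<and> v < hi x C)"
    by (rule iffD1[OF wparts_le_iff assms])
  then show "x \<in> wparts n" "y \<in> wparts n" by simp_all
  show "\<exists>C v. (C, v) \<in> y \<and> A \<subseteq> C" if "(A, w) \<in> x" for A w
    using * that by metis
  show "lo x C \<le> v \<and> v < hi x C" if "(C, v) \<in> y" for C v
    using * that by metis
qed

lemma wparts_leI:
  assumes "x \<in> wparts n" "y \<in> wparts n"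
    "\<And>A w. (A, w) \<in> x \<Longrightarrow> \<exists>C v. (C, v) \<in> y \<and> A \<subseteq> C"
    "\<And>C v. (C, v) \<in> y \<Longrightarrow> lo x C \<le> v \<and> v < hi x C"
  shows "(x, y) \<in> wparts_le n"
  by (rule iffD2[OF wparts_le_iff]) (intro conjI allI impI assms)

lemma below_block:
  assumes "x \<in> wparts n" "(A, w) \<in> x"
  shows "below x A = {(A, w)}"
proof
  show "{(A, w)} \<subseteq> below x A" using assms(2) by (simp add: below_def)
  show "below x A \<subseteq> {(A, w)}"
  proof (clarify)
    fix B v assume "(B, v) \<in> below x A"
    then have B: "(B, v) \<in> x" "B \<subseteq> A" by (simp_all add: below_def)
    have m: "Min B \<in> B" using wpartsD(5)[OF assms(1) B(1)] .
    show "B = A \<and> v = w"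
      using wparts_eq[OF assms(1) B(1) assms(2) m subsetD[OF B(2) m]] by (intro conjI)
  qed
qed

text \<open>Over one of its own blocks, \<open>x\<close> leaves a single weight available. This
  yields reflexivity, and the equality of weights in antisymmetry.\<close>

lemma lo_block [simp]: "x \<in> wparts n \<Longrightarrow> (A, w) \<in> x \<Longrightarrow> lo x A = w"
  and hi_block [simp]: "x \<in> wparts n \<Longrightarrow> (A, w) \<in> x \<Longrightarrow> hi x A = Suc w"
  by (simp_all add: lo_def hi_def below_block)

lemma wparts_le_refl: "x \<in> wparts n \<Longrightarrow> (x, x) \<in> wparts_le n"
  by (rule wparts_leI) auto

lemma wparts_le_antisym:
  assumes "(x, y) \<in> wparts_le n" "(y, x) \<in> wparts_le n"
  shows "x = y"
proof -
  have "x \<subseteq> y" if xy: "(x, y) \<in> wparts_le n" and yx: "(y, x) \<in> wparts_le n" for x y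
  proof
    fix p assume "p \<in> x"
    then obtain A w where p: "p = (A, w)" "(A, w) \<in> x" by (cases p) auto
    note x = wparts_leD(1)[OF xy]
    obtain C v where C: "(C, v) \<in> y" "A \<subseteq> C" using wparts_leD(3)[OF xy p(2)] by blast
    obtain A' w' where A': "(A', w') \<in> x" "C \<subseteq> A'" using wparts_leD(3)[OF yx C(1)] by blast
    have m: "Min A \<in> A" using wpartsD(5)[OF x p(2)] .
    then have "Min A \<in> A'" using C(2) A'(2) by blast
    then have "A = A'" using wparts_eq(1)[OF x p(2) A'(1) m] by blast
    then have "A = C" using C(2) A'(2) by simp
    then have "w = v" using wparts_leD(4)[OF xy C(1)] x p by simp
    then show "p \<in> y" using p C \<open>A = C\<close> by simp
  qed
  then show ?thesis using assms by blast
qed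

text \<open>The blocks of \<open>x\<close> inside \<open>D\<close> are grouped by the block of
  \<open>y\<close> that contains them. The general \<open>f\<close> serves \<open>lo\<close> and
  \<open>hi\<close> alike.\<close>

lemma sum_below:
  fixes f :: "nat set \<times> nat \<Rightarrow> nat"
  assumes xy: "(x, y) \<in> wparts_le n" and yz: "(y, z) \<in> wparts_le n" and D: "(D, v) \<in> z"
  shows "(\<Sum>p\<in>below x D. f p) = (\<Sum>q\<in>below y D. \<Sum>p\<in>below x (fst q). f p)"
proof -
  note x = wparts_leD(1)[OF xy] and y = wparts_leD(2)[OF xy] and z = wparts_leD(2)[OF yz]
  have "below x D = (\<Union>q\<in>below y D. below x (fst q))"
  proof
    show "(\<Union>q\<in>below y D. below x (fst q)) \<subseteq> below x D" unfolding below_def by blast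
    show "below x D \<subseteq> (\<Union>q\<in>below y D. below x (fst q))"
    proof (clarify)
      fix A w assume "(A, w) \<in> below x D"
      then have A: "(A, w) \<in> x" "A \<subseteq> D" by (auto simp: below_def)
      obtain C u where C: "(C, u) \<in> y" "A \<subseteq> C" using wparts_leD(3)[OF xy A(1)] by blast
      obtain D' v' where D': "(D', v') \<in> z" "C \<subseteq> D'" using wparts_leD(3)[OF yz C(1)] by blast
      have m: "Min A \<in> A" using wpartsD(5)[OF x A(1)] .
      then have "Min A \<in> D" "Min A \<in> D'" using A(2) C(2) D'(2) by blast+
      then have "D = D'" by (rule wparts_eq(1)[OF z D D'(1)])
      then have "(C, u) \<in> below y D" "(A, w) \<in> below x (fst (C, u))"
        using A C D' by (simp_all add: below_def)
      then show "(A, w) \<in> (\<Union>q\<in>below y D. below x (fst q))" by blast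
    qed
  qed
  moreover have "\<forall>q\<in>below y D. \<forall>q'\<in>below y D. q \<noteq> q' \<longrightarrow> below x (fst q) \<inter> below x (fst q') = {}"
  proof (clarify)
    fix B u C t
    assume "(B, u) \<in> below y D" "(C, t) \<in> below y D"
      and ne: "below x (fst (B, u)) \<inter> below x (fst (C, t)) \<noteq> {}"
    then have B: "(B, u) \<in> y" "(C, t) \<in> y" by (simp_all add: below_def)
    obtain A w where A: "(A, w) \<in> x" "A \<subseteq> B" "A \<subseteq> C" using ne by (auto simp: below_def)
    have m: "Min A \<in> A" using wpartsD(5)[OF x A(1)] .
    show "B = C \<and> u = t"
      using wparts_eq[OF y B subsetD[OF A(2) m] subsetD[OF A(3) m]] by (intro conjI)
  qed
  moreover have "finite (below y D)" "finite (below x E)" for E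
    using finite_wparts[OF x] finite_wparts[OF y] by (auto simp: below_def)
  ultimately show ?thesis by (auto intro!: sum.UNION_disjoint)
qed

text \<open>Adding up the bounds over the blocks of \<open>y\<close> inside \<open>D\<close> shows
  that the interval of weights available to \<open>D\<close> over \<open>y\<close> is contained in
  the one over \<open>x\<close>.\<close>

lemma wparts_le_trans:
  assumes xy: "(x, y) \<in> wparts_le n" and yz: "(y, z) \<in> wparts_le n"
  shows "(x, z) \<in> wparts_le n"
proof -
  have "lo x D \<le> v \<and> v < hi x D" if D: "(D, v) \<in> z" for D v
  proof -
    have "lo x D = (\<Sum>q\<in>below y D. lo x (fst q))" "hi x D = (\<Sum>q\<in>below y D. hi x (fst q))"
      using sum_below[OF xy yz D] unfolding lo_def hi_def by auto
    moreover have "(\<Sum>q\<in>below y D. lo x (fst q)) \<le> (\<Sum>q\<in>below y D. snd q)"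
      using wparts_leD(4)[OF xy] by (intro sum_mono) (auto simp: below_def)
    moreover have "(\<Sum>q\<in>below y D. Suc (snd q)) \<le> (\<Sum>q\<in>below y D. hi x (fst q))"
      using wparts_leD(4)[OF xy] by (intro sum_mono) (auto simp: below_def Suc_le_eq)
    ultimately have "lo x D \<le> lo y D" "hi y D \<le> hi x D" unfolding lo_def hi_def by auto
    then show ?thesis using wparts_leD(4)[OF yz D] by auto
  qed
  moreover have "\<exists>D v. (D, v) \<in> z \<and> A \<subseteq> D" if "(A, w) \<in> x" for A w
    using wparts_leD(3)[OF xy that] wparts_leD(3)[OF yz] by (meson subset_trans)
  ultimately show ?thesis using wparts_leI[OF wparts_leD(1)[OF xy] wparts_leD(2)[OF yz]] by blast
qed

section \<open>The bounded poset with the adjoined maximum\<close>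

lemma wparts_hat_le_simps [simp]:
  "(Some x, Some y) \<in> wparts_hat_le n \<longleftrightarrow> (x, y) \<in> wparts_le n"
  "(Some x, None) \<in> wparts_hat_le n \<longleftrightarrow> x \<in> wparts n"
  "(None, Some y) \<notin> wparts_hat_le n"
  "(None, None) \<in> wparts_hat_le n"
  by (auto simp: wparts_hat_le_def wparts_hat_def)

lemma wparts_hat_leD:
  assumes "(Some x, y) \<in> wparts_hat_le n"
  shows "x \<in> wparts n"
  using assms wparts_leD(1) by (cases y) auto

lemma partial_order_wparts_hat: "partial_order_on (wparts_hat n) (wparts_hat_le n)"
proof -
  have "refl_on (wparts_hat n) (wparts_hat_le n)"
    by (auto simp: refl_on_def wparts_hat_def wparts_le_refl)
  moreover have "wparts_hat_le n \<subseteq> wparts_hat n \<times> wparts_hat n"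
    by (auto simp: wparts_hat_def wparts_hat_le_def dest: wparts_leD(1,2))
  moreover have "trans (wparts_hat_le n)"
  proof (rule transI)
    fix x y z assume "(x, y) \<in> wparts_hat_le n" "(y, z) \<in> wparts_hat_le n"
    then show "(x, z) \<in> wparts_hat_le n"
      by (cases x; cases y; cases z) (auto intro: wparts_le_trans wparts_leD)
  qed
  moreover have "antisym (wparts_hat_le n)"
  proof (rule antisymI)
    fix x y assume "(x, y) \<in> wparts_hat_le n" "(y, x) \<in> wparts_hat_le n"
    then show "x = y" by (cases x; cases y) (simp_all add: wparts_le_antisym)
  qed
  ultimately show ?thesis by (auto simp: partial_order_on_def preorder_on_def)
qed

text \<open>Over the singletons of weight 0 the weights available to \<open>C\<close> are 0 up to
  \<open>card C - 1\<close>, which is exactly the weight bound in \<open>wparts\<close>.\<close>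

lemma wparts_bottom: "\<exists>b\<in>wparts n. \<forall>y\<in>wparts n. (b, y) \<in> wparts_le n"
proof -
  define b :: wpart where "b = (\<lambda>i. ({i}, 0)) ` {1..n}"
  have b: "b \<in> wparts n" unfolding wparts_iff b_def by auto
  moreover have "(b, y) \<in> wparts_le n" if y: "y \<in> wparts n" for y
  proof (rule wparts_leI[OF b y])
    fix C v assume C: "(C, v) \<in> y"
    have "below b C = (\<lambda>i. ({i}, 0)) ` C"
      using wpartsD(2)[OF y C] by (auto simp: below_def b_def)
    moreover have "inj_on (\<lambda>i. ({i}, 0::nat)) C" by (auto intro: inj_onI)
    ultimately have "lo b C = 0" "hi b C = card C"
      by (simp_all add: lo_def hi_def sum.reindex)
    then show "lo b C \<le> v \<and> v < hi b C" using wpartsD(4)[OF y C] by simp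
  next
    fix A w assume A: "(A, w) \<in> b"
    then obtain i where "A = {i}" "i \<in> {1..n}" by (auto simp: b_def)
    then show "\<exists>C v. (C, v) \<in> y \<and> A \<subseteq> C"
      using wparts_ex[OF y] by (metis empty_subsetI insert_subset)
  qed
  ultimately show ?thesis by blast
qed

lemma bounded_poset_wparts_hat: "bounded_poset (wparts_hat n) (wparts_hat_le n)"
proof -
  obtain b where "b \<in> wparts n" "\<forall>y\<in>wparts n. (b, y) \<in> wparts_le n"
    using wparts_bottom by blast
  then have "\<exists>b\<in>wparts_hat n. \<forall>x\<in>wparts_hat n. (b, x) \<in> wparts_hat_le n"
    by (intro bexI[of _ "Some b"]) (auto simp: wparts_hat_def)
  moreover have "\<exists>t\<in>wparts_hat n. \<forall>x\<in>wparts_hat n. (x, t) \<in> wparts_hat_le n"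
    by (auto simp: wparts_hat_def intro!: bexI[of _ None])
  ultimately show ?thesis using partial_order_wparts_hat by (simp add: bounded_poset_def)
qed

section \<open>The label poset\<close>

lemma Lambda_iff: "(a, b, u) \<in> Lambda n \<longleftrightarrow> 1 \<le> a \<and> a \<le> n \<and> a < b \<and> b \<le> n + 1 \<and> u \<le> 1"
  by (auto simp: Lambda_def Gamma_def)

lemma Lambda_le_iff:
  "((a, b, u), (a', b', u')) \<in> Lambda_le n \<longleftrightarrow>
     (a, b, u) \<in> Lambda n \<and> (a', b', u') \<in> Lambda n \<and> (a < a' \<or> a = a' \<and> b \<le> b' \<and> u \<le> u')"
  by (auto simp: Lambda_le_def Lambda_def Gamma_le_def Gamma_def)

lemma strict_Lambda_leI:
  assumes "(a, b, u) \<in> Lambda n" "(a', b', u') \<in> Lambda n"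
    "a < a' \<or> a = a' \<and> b \<le> b' \<and> u \<le> u' \<and> (b < b' \<or> u \<noteq> u')"
  shows "((a, b, u), (a', b', u')) \<in> strict (Lambda_le n)"
  using assms by (auto simp: strict_iff Lambda_le_iff)

lemma partial_order_Lambda: "partial_order_on (Lambda n) (Lambda_le n)"
proof -
  have "refl_on (Lambda n) (Lambda_le n)"
    by (auto simp: refl_on_def Lambda_le_iff)
  moreover have "Lambda_le n \<subseteq> Lambda n \<times> Lambda n" by (auto simp: Lambda_le_iff)
  moreover have "trans (Lambda_le n)" by (rule transI) (auto simp: Lambda_le_iff)
  moreover have "antisym (Lambda_le n)" by (rule antisymI) (auto simp: Lambda_le_iff)
  ultimately show ?thesis by (auto simp: partial_order_on_def preorder_on_def)
qed

section \<open>Merging two blocks\<close>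

lemma wparts_Min_eq:
  assumes "x \<in> wparts n" "(A, w) \<in> x" "(B, v) \<in> x" "Min A = Min B"
  shows "A = B" "w = v"
proof -
  have "Min A \<in> A" "Min A \<in> B"
    using wpartsD(5)[OF assms(1,2)] wpartsD(5)[OF assms(1,3)] assms(4) by simp_all
  from wparts_eq[OF assms(1-3) this] show "A = B" "w = v" .
qed

lemma wparts_subset_eq:
  assumes "x \<in> wparts n" "(A, w) \<in> x" "(B, v) \<in> x" "A \<subseteq> B"
  shows "A = B" "w = v"
proof -
  have m: "Min A \<in> A" using wpartsD(5)[OF assms(1,2)] .
  from wparts_eq[OF assms(1-3) m subsetD[OF assms(4) m]] show "A = B" "w = v" .
qed

lemma wparts_weight_eq:
  assumes "x \<in> wparts n" "(A, w) \<in> x" "(A, v) \<in> x"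
  shows "w = v"
  using wparts_subset_eq(2)[OF assms order.refl] .

locale merge =
  fixes n x A w B v u z
  assumes x: "x \<in> wparts n" and m: "merges x A w B v u z"
begin

lemma A: "(A, w) \<in> x" and B: "(B, v) \<in> x" and Min_less: "Min A < Min B" and u: "u \<le> 1"
  and z: "z = insert (A \<union> B, u + w + v) (x - {(A, w), (B, v)})"
  using m by (auto simp: merges_def)

lemma neq: "A \<noteq> B" using Min_less by auto

lemma disj: "A \<inter> B = {}"
proof (rule ccontr)
  assume "A \<inter> B \<noteq> {}"
  then obtain i where "i \<in> A" "i \<in> B" by blast
  from wparts_eq(1)[OF x A B this] neq show False by simp
qed

lemma union_notin: "(A \<union> B, t) \<notin> x"
proof
  assume "(A \<union> B, t) \<in> x"
  from wparts_subset_eq(1)[OF x A this Un_upper1] wparts_subset_eq(1)[OF x B this Un_upper2]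
  have "A = B" by (rule trans[OF _ sym])
  with neq show False ..
qed

lemma mem_iff: "(C, t) \<in> z \<longleftrightarrow> C = A \<union> B \<and> t = u + w + v \<or> (C, t) \<in> x \<and> C \<noteq> A \<and> C \<noteq> B"
proof -
  have "t = w" if "(A, t) \<in> x" using wparts_weight_eq[OF x that A] .
  moreover have "t = v" if "(B, t) \<in> x" using wparts_weight_eq[OF x that B] .
  ultimately show ?thesis unfolding z by blast
qed

lemma Min_union: "Min (A \<union> B) = Min A"
  using Min_Un[of A B] wpartsD[OF x A] wpartsD[OF x B] Min_less by simp

lemma card_less: "card z < card x"
proof -
  have "card (x - {(A, w), (B, v)}) = card x - 2"
    using A B neq by (subst card_Diff_subset) auto
  \<comment> \<open>Guarantees that the truncated subtraction of 2 above is exact.\<close>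
  moreover have "card {(A, w), (B, v)} \<le> card x"
    using A B finite_wparts[OF x] by (intro card_mono) auto
  moreover have "card z \<le> Suc (card (x - {(A, w), (B, v)}))" unfolding z by (rule card_insert_le_m1) simp_all
  ultimately show ?thesis using neq by simp
qed

lemma z_wparts: "z \<in> wparts n"
proof -
  have bd: "C \<noteq> {} \<and> C \<subseteq> {1..n} \<and> t < card C" if "(C, t) \<in> z" for C t
  proof (cases "(C, t) \<in> x")
    case True
    then show ?thesis using wpartsD[OF x] by blast
  next
    case False
    then have C: "C = A \<union> B" "t = u + w + v" using that mem_iff by auto
    \<comment> \<open>As \<open>w < card A\<close> and \<open>v < card B\<close>, the sum
      \<open>w + v\<close> stays at least 2 below \<open>card C\<close>, which leaves room for
      \<open>u \<le> 1\<close>.\<close>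
    have "card C = card A + card B"
      unfolding C using wpartsD(3)[OF x] A B disj by (intro card_Un_disjoint) auto
    then show ?thesis
      using wpartsD(1,2,4)[OF x A] wpartsD(1,2,4)[OF x B] u C by auto
  qed
  have dj: "C = D \<and> t = s" if C: "(C, t) \<in> z" and D: "(D, s) \<in> z" and i: "i \<in> C" "i \<in> D" for C t D s i
  proof -
    have *: False if "i \<in> A \<union> B" "(E, r) \<in> x" "E \<noteq> A" "E \<noteq> B" "i \<in> E" for E r
      using that wparts_eq(1)[OF x A that(2)] wparts_eq(1)[OF x B that(2)] by blast
    consider "C = A \<union> B \<and> t = u + w + v" "D = A \<union> B \<and> s = u + w + v"
      | "C = A \<union> B" "(D, s) \<in> x" "D \<noteq> A" "D \<noteq> B" | "D = A \<union> B" "(C, t) \<in> x" "C \<noteq> A" "C \<noteq> B"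
      | "(C, t) \<in> x" "(D, s) \<in> x"
      using C D unfolding mem_iff by blast
    then show ?thesis
    proof cases
      case 1
      then show ?thesis by simp
    next
      case 2
      then show ?thesis using * i by blast
    next
      case 3
      then show ?thesis using * i by blast
    next
      case 4
      from wparts_eq[OF x this i] show ?thesis by (rule conjI)
    qed
  qed
  have cov: "\<exists>C t. (C, t) \<in> z \<and> i \<in> C" if i: "i \<in> {1..n}" for i
  proof -
    obtain C t where C: "(C, t) \<in> x" "i \<in> C" using wparts_ex[OF x i] .
    then show ?thesis using mem_iff by (cases "C = A \<or> C = B") blast+
  qed
  show ?thesis
    unfolding wparts_iff
  proof (intro conjI ballI impI)
    fix p assume "p \<in> z"
    then have p: "(fst p, snd p) \<in> z" by simp
    from bd[OF p] show "fst p \<noteq> {}" "fst p \<subseteq> {1..n}" "snd p < card (fst p)" by simp_all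
    fix q assume "q \<in> z" "fst p \<inter> fst q \<noteq> {}"
    then obtain i where i: "i \<in> fst p" "i \<in> fst q" and q: "(fst q, snd q) \<in> z" by auto
    from dj[OF p q i] show "p = q" by (simp add: prod_eq_iff)
  next
    fix i assume "i \<in> {1..n}"
    from cov[OF this] show "\<exists>p\<in>z. i \<in> fst p" by force
  qed
qed

lemma sum_below_merge:
  fixes f :: "nat set \<times> nat \<Rightarrow> nat"
  assumes D: "A \<union> B \<subseteq> D"
  shows "sum f (below z D) + f (A, w) + f (B, v) = sum f (below x D) + f (A \<union> B, u + w + v)"
proof -
  define R where "R = below x D - {(A, w), (B, v)}"
  have fin: "finite R" using finite_wparts[OF x] by (simp add: R_def below_def)
  have "below x D = insert (A, w) (insert (B, v) R)"
    using A B D by (auto simp: R_def below_def)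
  moreover have "(A, w) \<notin> insert (B, v) R" "(B, v) \<notin> R" using neq by (auto simp: R_def)
  ultimately have "sum f (below x D) = f (A, w) + f (B, v) + sum f R"
    using fin by (simp add: add.assoc)
  moreover have "below z D = insert (A \<union> B, u + w + v) R"
    using D unfolding z by (auto simp: R_def below_def)
  moreover have "(A \<union> B, u + w + v) \<notin> R" using union_notin by (simp add: R_def below_def)
  ultimately show ?thesis using fin by simp
qed

text \<open>A merge shortens the interval of available weights by one: at the upper end if
  \<open>u = 0\<close>, at the lower end if \<open>u = 1\<close>. The \<open>Suc\<close> on the left
  avoids natural subtraction.\<close>

lemma lo_merge: "A \<union> B \<subseteq> D \<Longrightarrow> lo z D = lo x D + u"
  and hi_merge: "A \<union> B \<subseteq> D \<Longrightarrow> Suc (hi z D) = hi x D + u"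
  using sum_below_merge[of D snd] sum_below_merge[of D "\<lambda>p. Suc (snd p)"]
  by (simp_all add: lo_def hi_def)

lemma below_other:
  assumes "A \<inter> D = {}" "B \<inter> D = {}"
  shows "below z D = below x D"
  using assms wpartsD(1)[OF x A] wpartsD(1)[OF x B] unfolding z below_def by auto

text \<open>At least two weights are available to \<open>D\<close>. This is why increment 1 is
  possible whenever increment 0 is not.\<close>

lemma two_blocks_below:
  assumes "A \<union> B \<subseteq> D"
  shows "lo x D + 2 \<le> hi x D"
proof -
  have "card {(A, w), (B, v)} \<le> card (below x D)"
    using A B assms finite_wparts[OF x] by (intro card_mono) (auto simp: below_def)
  then show ?thesis using neq by (simp add: hi_eq)
qed

lemma le_z: "(x, z) \<in> wparts_le n"
proof (rule wparts_leI[OF x z_wparts])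
  show "\<exists>C t. (C, t) \<in> z \<and> D \<subseteq> C" if "(D, r) \<in> x" for D r
    using that mem_iff by (cases "D = A \<or> D = B") blast+
  show "lo x C \<le> t \<and> t < hi x C" if C: "(C, t) \<in> z" for C t
  proof (cases "C = A \<union> B")
    case True
    then have "t = u + w + v" using C mem_iff union_notin by blast
    moreover have "lo z C = t" "hi z C = Suc t" using C z_wparts by simp_all
    ultimately show ?thesis using lo_merge[of C] hi_merge[of C] two_blocks_below[of C] u True by simp
  next
    case False
    then have "(C, t) \<in> x" using C mem_iff by blast
    then show ?thesis using x by simp
  qed
qed

text \<open>Read off backwards: \<open>A \<union> B\<close> is a block of \<open>z\<close>, so its
  interval over \<open>z\<close> is a single weight, and undoing the merge restores the lost
  end.\<close>

lemma lo_union: "lo x (A \<union> B) = w + v" and hi_union: "hi x (A \<union> B) = Suc (Suc (w + v))"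
proof -
  have "(A \<union> B, u + w + v) \<in> z" using mem_iff by blast
  then have "lo z (A \<union> B) = u + w + v" "hi z (A \<union> B) = Suc (u + w + v)"
    using z_wparts by simp_all
  then show "lo x (A \<union> B) = w + v" "hi x (A \<union> B) = Suc (Suc (w + v))"
    using lo_merge[of "A \<union> B"] hi_merge[of "A \<union> B"] by simp_all
qed

lemma z_neq: "z \<noteq> x"
  using card_less by auto

text \<open>The merge affects only the interval of the block \<open>C\<close> of \<open>y\<close>
  around \<open>A \<union> B\<close>; the two inequalities say that \<open>t\<close> lies in the
  shortened interval. They involve \<open>A\<close> and \<open>B\<close> only through
  \<open>C\<close>.\<close>

lemma z_le_iff:
  assumes y: "(x, y) \<in> wparts_le n"
  shows "(z, y) \<in> wparts_le n \<longleftrightarrow>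
    (\<exists>C t. (C, t) \<in> y \<and> A \<union> B \<subseteq> C \<and> lo x C + u \<le> t \<and> t + 2 \<le> hi x C + u)"
proof
  assume zy: "(z, y) \<in> wparts_le n"
  have "(A \<union> B, u + w + v) \<in> z" using mem_iff by blast
  then obtain C t where C: "(C, t) \<in> y" "A \<union> B \<subseteq> C" using wparts_leD(3)[OF zy] by blast
  moreover have "lo x C + u \<le> t \<and> t + 2 \<le> hi x C + u"
    using wparts_leD(4)[OF zy C(1)] lo_merge[OF C(2)] hi_merge[OF C(2)] by simp
  ultimately show "\<exists>C t. (C, t) \<in> y \<and> A \<union> B \<subseteq> C \<and> lo x C + u \<le> t \<and> t + 2 \<le> hi x C + u"
    by blast
next
  assume "\<exists>C t. (C, t) \<in> y \<and> A \<union> B \<subseteq> C \<and> lo x C + u \<le> t \<and> t + 2 \<le> hi x C + u"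
  then obtain C t where C: "(C, t) \<in> y" "A \<union> B \<subseteq> C" "lo x C + u \<le> t" "t + 2 \<le> hi x C + u"
    by blast
  note yw = wparts_leD(2)[OF y]
  show "(z, y) \<in> wparts_le n"
  proof (rule wparts_leI[OF z_wparts yw])
    show "\<exists>D s. (D, s) \<in> y \<and> E \<subseteq> D" if "(E, r) \<in> z" for E r
      using that mem_iff C(1,2) wparts_leD(3)[OF y] by blast
    fix D s assume D: "(D, s) \<in> y"
    show "lo z D \<le> s \<and> s < hi z D"
    proof (cases "D = C")
      case True
      then have "s = t" using wparts_weight_eq[OF yw D] C(1) by simp
      then show ?thesis using C lo_merge[OF C(2)] hi_merge[OF C(2)] True by simp
    next
      case False
      have "D \<inter> C = {}" using wparts_eq(1)[OF yw D C(1)] False by blast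
      then have "below z D = below x D" using C(2) by (intro below_other) blast+
      then have "lo z D = lo x D" "hi z D = hi x D" by (simp_all add: lo_def hi_def)
      then show ?thesis using wparts_leD(4)[OF y D] by simp
    qed
  qed
qed

end

text \<open>Comparability instead of equality of \<open>z'\<close> and \<open>z\<close> makes this
  serve twice: it makes labels well defined, and it excludes elements between \<open>x\<close> and a
  merge of \<open>x\<close>.\<close>

lemma merges_unique:
  assumes x: "x \<in> wparts n" and m: "merges x A w B v u z" and m': "merges x A' w' B' v' u' z'"
    and le: "(z', z) \<in> wparts_le n"
  shows "A' = A \<and> B' = B \<and> u' = u \<and> z' = z"
proof -
  interpret M: merge n x A w B v u z using x m by unfold_locales
  interpret M': merge n x A' w' B' v' u' z' using x m' by unfold_locales
  obtain C t where C: "(C, t) \<in> z" "A' \<union> B' \<subseteq> C" "lo x C + u' \<le> t" "t + 2 \<le> hi x C + u'"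
    using M'.z_le_iff[OF M.le_z] le by blast
  \<comment> \<open>\<open>C\<close> contains the two different blocks \<open>A'\<close> and
    \<open>B'\<close> of \<open>x\<close>, so it must be the one new block of
    \<open>z\<close>.\<close>
  have "(C, t) \<notin> x"
  proof
    assume "(C, t) \<in> x"
    then have "A' = C" "B' = C"
      using wparts_subset_eq(1)[OF x M'.A] wparts_subset_eq(1)[OF x M'.B] C(2) by blast+
    then show False using M'.neq by simp
  qed
  then have AB: "C = A \<union> B" "t = u + w + v" using C(1) M.mem_iff by blast+
  have in_AB: "D = A \<or> D = B" if D: "(D, s) \<in> x" "D \<subseteq> A \<union> B" for D s
  proof -
    have "Min D \<in> D" using wpartsD(5)[OF x D(1)] .
    then show ?thesis using wparts_eq(1)[OF x D(1) M.A] wparts_eq(1)[OF x D(1) M.B] D(2) by blast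
  qed
  have "A' = A \<or> A' = B" "B' = A \<or> B' = B"
    using in_AB[OF M'.A] in_AB[OF M'.B] C(2) AB(1) by blast+
  then have eq: "A' = A" "B' = B" using M.Min_less M'.Min_less by auto
  then have "w' = w" "v' = v"
    using wparts_weight_eq[OF x M.A] wparts_weight_eq[OF x M.B] M'.A M'.B by simp_all
  moreover have "u' = u"
    using C(3,4) AB M.lo_union M.hi_union by simp
  ultimately show ?thesis using eq M.z M'.z by simp
qed

lemma wlabel_merges:
  assumes "x \<in> wparts n" "merges x A w B v u z"
  shows "wlabel n (Some x) (Some z) = (Min A, Min B, u)"
proof -
  have zz: "(z, z) \<in> wparts_le n"
    using merge.z_wparts[OF merge.intro[OF assms]] by (rule wparts_le_refl)
  have "(THE l. \<exists>A wA B wB u. merges x A wA B wB u z \<and> l = (Min A, Min B, u)) = (Min A, Min B, u)"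
  proof (rule the_equality)
    show "\<exists>A' wA B' wB u'. merges x A' wA B' wB u' z \<and> (Min A, Min B, u) = (Min A', Min B', u')"
      using assms(2) by blast
    fix l assume "\<exists>A wA B wB u. merges x A wA B wB u z \<and> l = (Min A, Min B, u)"
    then obtain A' w' B' v' u' where m': "merges x A' w' B' v' u' z" and l: "l = (Min A', Min B', u')"
      by blast
    from merges_unique[OF assms m' zz] l show "l = (Min A, Min B, u)" by simp
  qed
  then show ?thesis by simp
qed

section \<open>The least label above a weighted partition\<close>

definition blocks :: "nat \<Rightarrow> wpart option \<Rightarrow> nat set set" where
  "blocks n y = (case y of None \<Rightarrow> {{1..n}} | Some y' \<Rightarrow> fst ` y')"

text \<open>The weight increment \<open>u\<close>, spent on a merge inside the block \<open>C\<close> of \<open>y\<close>, leaves \<open>y\<close> reachable.\<close>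

definition admissible :: "wpart \<Rightarrow> wpart option \<Rightarrow> nat set \<Rightarrow> nat \<Rightarrow> bool" where
  "admissible x y C u = (case y of None \<Rightarrow> True
     | Some y' \<Rightarrow> \<exists>t. (C, t) \<in> y' \<and> lo x C + u \<le> t \<and> t + 2 \<le> hi x C + u)"

lemma blocks_simps [simp]:
  "blocks n None = {{1..n}}" "blocks n (Some y) = fst ` y"
  by (simp_all add: blocks_def)

lemma admissible_simps [simp]:
  "admissible x None C u"
  "admissible x (Some y) C u \<longleftrightarrow> (\<exists>t. (C, t) \<in> y \<and> lo x C + u \<le> t \<and> t + 2 \<le> hi x C + u)"
  by (simp_all add: admissible_def)

lemma blocks_eq:
  assumes "(Some x, y) \<in> wparts_hat_le n" "C \<in> blocks n y" "D \<in> blocks n y" "i \<in> C" "i \<in> D"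
  shows "C = D"
proof (cases y)
  case None
  then show ?thesis using assms by simp
next
  case (Some y')
  then have y: "y' \<in> wparts n" using assms(1) wparts_leD(2) by auto
  obtain s t where "(C, s) \<in> y'" "(D, t) \<in> y'" using assms Some by auto
  from wparts_eq(1)[OF y this assms(4,5)] show ?thesis .
qed

lemma blocks_ex:
  assumes "(Some x, y) \<in> wparts_hat_le n" "(A, w) \<in> x"
  shows "\<exists>C\<in>blocks n y. A \<subseteq> C"
proof (cases y)
  case None
  then show ?thesis using assms wpartsD(2) by simp
next
  case (Some y')
  then obtain C t where "(C, t) \<in> y'" "A \<subseteq> C"
    using assms wparts_leD(3) by (metis wparts_hat_le_simps(1))
  then show ?thesis using Some by force
qed

lemma blocks_subset:
  assumes "(Some x, y) \<in> wparts_hat_le n" "C \<in> blocks n y"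
  shows "C \<subseteq> {1..n}"
proof (cases y)
  case None
  then show ?thesis using assms by simp
next
  case (Some y')
  then have y: "y' \<in> wparts n" using assms(1) wparts_leD(2) by auto
  obtain s where "(C, s) \<in> y'" using assms Some by auto
  from wpartsD(2)[OF y this] show ?thesis .
qed

text \<open>If no block of \<open>x\<close> remains to be merged and \<open>y\<close> is a weighted
  partition, the blocks of \<open>x\<close> and \<open>y\<close> agree, and so do their weights,
  since each interval is a single weight. What is left is the one step that is not a merge, from
  \<open>[n]\<close> to the adjoined maximum.\<close>

lemma all_blocks_kept:
  assumes le: "(Some x, y) \<in> wparts_hat_le n" and neq: "Some x \<noteq> y" and n: "n \<ge> 1"
    and all: "\<And>A w. (A, w) \<in> x \<Longrightarrow> A \<in> blocks n y"
  shows "y = None \<and> (\<exists>i<n. x = {({1..n}, i)})"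
proof (cases y)
  case None
  have x: "x \<in> wparts n" using wparts_hat_leD[OF le] .
  have "1 \<in> {1..n}" using n by simp
  then obtain A i where A: "(A, i) \<in> x" using wparts_ex[OF x] by blast
  have full: "B = {1..n}" if "(B, j) \<in> x" for B j using all[OF that] None by simp
  then have An: "({1..n}, i) \<in> x" using A by blast
  have eq: "(B, j) = ({1..n}, i)" if B: "(B, j) \<in> x" for B j
  proof -
    have "({1..n}, j) \<in> x" using full[OF B] B by blast
    from wparts_weight_eq[OF x this An] full[OF B] show ?thesis by simp
  qed
  have "x = {({1..n}, i)}"
  proof
    show "x \<subseteq> {({1..n}, i)}"
    proof
      fix p assume "p \<in> x"
      then show "p \<in> {({1..n}, i)}" using eq[of "fst p" "snd p"] by simp
    qed
  qed (use An in simp)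
  moreover have "i < n" using wpartsD(4)[OF x An] by simp
  ultimately show ?thesis using None by blast
next
  case (Some y')
  then have xy: "(x, y') \<in> wparts_le n" using le by simp
  note x = wparts_leD(1)[OF xy] and y = wparts_leD(2)[OF xy]
  have sub: "(A, w) \<in> y'" if A: "(A, w) \<in> x" for A w
  proof -
    obtain t where t: "(A, t) \<in> y'" using all[OF A] Some by auto
    then have "w = t" using wparts_leD(4)[OF xy t] A x by simp
    then show ?thesis using t by simp
  qed
  have "(C, t) \<in> x" if C: "(C, t) \<in> y'" for C t
  proof -
    have m: "Min C \<in> C" using wpartsD(5)[OF y C] .
    then have "Min C \<in> {1..n}" using wpartsD(2)[OF y C] by blast
    then obtain A w where A: "(A, w) \<in> x" "Min C \<in> A" using wparts_ex[OF x] by blast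
    from wparts_eq[OF y C sub[OF A(1)] m A(2)] A(1) show ?thesis by simp
  qed
  then have "x = y'" using sub by (intro equalityI subrelI)
  then show ?thesis using neq Some by simp
qed

lemma merges_hat_le_iff:
  assumes le: "(Some x, y) \<in> wparts_hat_le n" and m: "merges x A w B v u z"
  shows "(Some z, y) \<in> wparts_hat_le n \<longleftrightarrow> (\<exists>C\<in>blocks n y. A \<union> B \<subseteq> C \<and> admissible x y C u)"
proof -
  interpret merge n x A w B v u z using wparts_hat_leD[OF le] m by unfold_locales
  show ?thesis
  proof (cases y)
    case None
    then show ?thesis using z_wparts wpartsD(2)[OF x A] wpartsD(2)[OF x B] by simp
  next
    case (Some y')
    then have xy: "(x, y') \<in> wparts_le n" using le by simp
    have "(\<exists>C\<in>fst ` y'. A \<union> B \<subseteq> C \<and> (\<exists>t. (C, t) \<in> y' \<and> lo x C + u \<le> t \<and> t + 2 \<le> hi x C + u)) \<longleftrightarrow>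
      (\<exists>C t. (C, t) \<in> y' \<and> A \<union> B \<subseteq> C \<and> lo x C + u \<le> t \<and> t + 2 \<le> hi x C + u)"
      by (metis fst_conv imageI)
    then show ?thesis unfolding Some blocks_simps admissible_simps wparts_hat_le_simps z_le_iff[OF xy]
      by (rule sym)
  qed
qed

text \<open>The step of the increasing chain from \<open>x\<close> to \<open>y\<close>: among the blocks of \<open>x\<close> which are not blocks
  of \<open>y\<close>, take the one with the least minimum, and merge it with the next block of \<open>x\<close> inside the same
  block \<open>C\<close> of \<open>y\<close>, with weight increment 0 whenever this leaves \<open>y\<close> reachable.\<close>

definition least_merge ::
  "nat \<Rightarrow> wpart \<Rightarrow> wpart option \<Rightarrow> nat set \<Rightarrow> nat \<Rightarrow> nat set \<Rightarrow> nat \<Rightarrow> nat \<Rightarrow> nat set \<Rightarrow> wpart \<Rightarrow> bool" where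
  "least_merge n x y A w B v u C z \<longleftrightarrow>
     merges x A w B v u z \<and> C \<in> blocks n y \<and> A \<union> B \<subseteq> C \<and> admissible x y C u \<and>
     (\<forall>D s. (D, s) \<in> x \<longrightarrow> D \<notin> blocks n y \<longrightarrow> Min A \<le> Min D) \<and>
     (\<forall>D s. (D, s) \<in> x \<longrightarrow> D \<subseteq> C \<longrightarrow> D \<noteq> A \<longrightarrow> Min B \<le> Min D) \<and>
     (admissible x y C 0 \<longrightarrow> u = 0)"

inductive least_cover :: "nat \<Rightarrow> wpart option \<Rightarrow> wpart option \<Rightarrow> wpart option \<Rightarrow> bool" for n where
  merge: "least_merge n x y A w B v u C z \<Longrightarrow> least_cover n (Some x) y (Some z)"
| top: "i < n \<Longrightarrow> least_cover n (Some {({1..n}, i)}) None None"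

lemma least_coverE:
  assumes "least_cover n x y z"
  obtains (merge) x' A w B v u C z' where "x = Some x'" "z = Some z'" "least_merge n x' y A w B v u C z'"
  | (top) i where "i < n" "x = Some {({1..n}, i)}" "y = None" "z = None"
  using assms
proof (cases rule: least_cover.cases)
  case (merge x' A w B v u C z')
  then show thesis using that(1)[of x' z' A w B v u C] by simp
next
  case (top i)
  then show thesis using that(2)[of i] by simp
qed

lemma least_mergeD:
  assumes "least_merge n x y A w B v u C z"
  shows "merges x A w B v u z" "C \<in> blocks n y" "A \<union> B \<subseteq> C" "admissible x y C u"
    "\<And>D s. (D, s) \<in> x \<Longrightarrow> D \<notin> blocks n y \<Longrightarrow> Min A \<le> Min D"
    "\<And>D s. (D, s) \<in> x \<Longrightarrow> D \<subseteq> C \<Longrightarrow> D \<noteq> A \<Longrightarrow> Min B \<le> Min D"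
    "admissible x y C 0 \<Longrightarrow> u = 0"
proof -
  note * = assms[unfolded least_merge_def]
  from * show "merges x A w B v u z" by (elim conjE)
  from * show "C \<in> blocks n y" by (elim conjE)
  from * show "A \<union> B \<subseteq> C" by (elim conjE)
  from * show "admissible x y C u" by (elim conjE)
  from * have "\<forall>D s. (D, s) \<in> x \<longrightarrow> D \<notin> blocks n y \<longrightarrow> Min A \<le> Min D" by (elim conjE)
  then show "Min A \<le> Min D" if "(D, s) \<in> x" "D \<notin> blocks n y" for D s using that by metis
  from * have "\<forall>D s. (D, s) \<in> x \<longrightarrow> D \<subseteq> C \<longrightarrow> D \<noteq> A \<longrightarrow> Min B \<le> Min D" by (elim conjE)
  then show "Min B \<le> Min D" if "(D, s) \<in> x" "D \<subseteq> C" "D \<noteq> A" for D s using that by metis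
  from * have "admissible x y C 0 \<longrightarrow> u = 0" by (elim conjE)
  then show "u = 0" if "admissible x y C 0" using that by metis
qed

lemma blocks_notin:
  assumes le: "(Some x, y) \<in> wparts_hat_le n" and A: "(A, w) \<in> x" and B: "(B, v) \<in> x"
    and neq: "A \<noteq> B" and C: "C \<in> blocks n y" "A \<subseteq> C" "B \<subseteq> C"
  shows "A \<notin> blocks n y"
proof
  assume a: "A \<in> blocks n y"
  have x: "x \<in> wparts n" using wparts_hat_leD[OF le] .
  have "Min A \<in> A" using wpartsD(5)[OF x A] .
  then have "A = C" using blocks_eq[OF le a C(1)] C(2) by blast
  then have "B = A" using wparts_subset_eq(1)[OF x B A] C(3) by blast
  with neq show False by simp
qed

lemma least_merge_ex:
  assumes le: "(Some x, y) \<in> wparts_hat_le n" and D: "(D, s) \<in> x" "D \<notin> blocks n y"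
  shows "\<exists>A w B v u C z. least_merge n x y A w B v u C z"
proof -
  have x: "x \<in> wparts n" using wparts_hat_leD[OF le] .
  have "\<exists>p. (p \<in> x \<and> fst p \<notin> blocks n y) \<and>
      (\<forall>q. q \<in> x \<and> fst q \<notin> blocks n y \<longrightarrow> Min (fst p) \<le> Min (fst q))"
    by (rule ex_has_least_nat[where k = "(D, s)"]) (use D in simp)
  then obtain A w where A: "(A, w) \<in> x" "A \<notin> blocks n y"
    and A_least: "\<And>D s. (D, s) \<in> x \<Longrightarrow> D \<notin> blocks n y \<Longrightarrow> Min A \<le> Min D"
    by auto
  obtain C where C: "C \<in> blocks n y" "A \<subseteq> C" using blocks_ex[OF le A(1)] by blast
  \<comment> \<open>A point of \<open>C\<close> outside \<open>A\<close> lies in another block of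
    \<open>x\<close> inside \<open>C\<close>, so there is a candidate for \<open>B\<close>.\<close>
  then have "\<not> C \<subseteq> A" using A(2) by (metis subset_antisym)
  then obtain i where i: "i \<in> C" "i \<notin> A" by blast
  then have "i \<in> {1..n}" using blocks_subset[OF le C(1)] by blast
  then obtain E r where E: "(E, r) \<in> x" "i \<in> E" using wparts_ex[OF x] by blast
  obtain C' where C': "C' \<in> blocks n y" "E \<subseteq> C'" using blocks_ex[OF le E(1)] by blast
  then have "C = C'" using blocks_eq[OF le C(1) C'(1) i(1)] E(2) by blast
  then have EC: "E \<subseteq> C" using C'(2) by simp
  have EA: "E \<noteq> A" using E i by blast
  have "\<exists>p. (p \<in> x \<and> fst p \<subseteq> C \<and> fst p \<noteq> A) \<and>
      (\<forall>q. q \<in> x \<and> fst q \<subseteq> C \<and> fst q \<noteq> A \<longrightarrow> Min (fst p) \<le> Min (fst q))"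
    by (rule ex_has_least_nat[where k = "(E, r)"]) (use E EC EA in simp)
  then obtain B v where B: "(B, v) \<in> x" "B \<subseteq> C" "B \<noteq> A"
    and B_least: "\<And>D s. (D, s) \<in> x \<Longrightarrow> D \<subseteq> C \<Longrightarrow> D \<noteq> A \<Longrightarrow> Min B \<le> Min D"
  proof (elim exE conjE)
    fix p assume p: "p \<in> x" "fst p \<subseteq> C" "fst p \<noteq> A"
      and "\<forall>q. q \<in> x \<and> fst q \<subseteq> C \<and> fst q \<noteq> A \<longrightarrow> Min (fst p) \<le> Min (fst q)"
    then have "Min (fst p) \<le> Min D" if "(D, s) \<in> x" "D \<subseteq> C" "D \<noteq> A" for D s
      using that by (metis fst_conv)
    then show thesis using that[of "fst p" "snd p"] p by simp
  qed
  \<comment> \<open>So \<open>B\<close> took part in the choice of \<open>A\<close>, which gives the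
    order of minima that \<open>merges\<close> demands.\<close>
  have "B \<notin> blocks n y" using blocks_notin[OF le B(1) A(1) B(3) C(1) B(2) C(2)] .
  then have "Min A \<le> Min B" using A_least[OF B(1)] by simp
  moreover have "Min A \<noteq> Min B" using wparts_Min_eq(1)[OF x A(1) B(1)] B(3) by blast
  ultimately have lt: "Min A < Min B" by simp
  define u :: nat where "u = (if admissible x y C 0 then 0 else 1)"
  have m: "merges x A w B v u (x - {(A, w), (B, v)} \<union> {(A \<union> B, u + w + v)})"
    using A B lt by (simp add: merges_def u_def)
  interpret M: merge n x A w B v u "x - {(A, w), (B, v)} \<union> {(A \<union> B, u + w + v)}"
    using x m by unfold_locales
  have AB: "A \<union> B \<subseteq> C" using B C by simp
  have "admissible x y C u"
  proof (cases "admissible x y C 0")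
    case True
    then show ?thesis by (simp add: u_def)
  next
    \<comment> \<open>If increment 0 is not admissible, \<open>t\<close> is the largest available
      weight \<open>hi x C - 1\<close>; with two blocks inside \<open>C\<close> it exceeds
      \<open>lo x C\<close>, so increment 1 is admissible.\<close>
    case False
    then obtain y' where y': "y = Some y'" by (cases y) auto
    then obtain t where t: "(C, t) \<in> y'" using C(1) by auto
    then have "lo x C \<le> t \<and> t < hi x C" using le y' wparts_leD(4) by simp
    moreover have "\<not> t + 2 \<le> hi x C" using False y' t calculation by auto
    ultimately have "lo x C + 1 \<le> t \<and> t + 2 \<le> hi x C + 1"
      using M.two_blocks_below[OF AB] by simp
    then show ?thesis using False y' t by (auto simp: u_def)
  qed
  then have "least_merge n x y A w B v u C (x - {(A, w), (B, v)} \<union> {(A \<union> B, u + w + v)})"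
    unfolding least_merge_def
    by (intro conjI allI impI m C(1) AB A_least B_least) (simp_all add: u_def)
  then show ?thesis by (intro exI)
qed

lemma least_cover_ex:
  assumes le: "(x, y) \<in> wparts_hat_le n" and neq: "x \<noteq> y" and n: "n \<ge> 1"
  shows "\<exists>z. least_cover n x y z"
proof -
  obtain x' where x': "x = Some x'" using le neq by (cases x; cases y) auto
  show ?thesis
  proof (cases "\<exists>D s. (D, s) \<in> x' \<and> D \<notin> blocks n y")
    case True
    then obtain D s where D: "(D, s) \<in> x'" "D \<notin> blocks n y" by (elim exE conjE)
    obtain A w B v u C z where "least_merge n x' y A w B v u C z"
      using least_merge_ex[OF le[unfolded x'] D] by (elim exE)
    from least_cover.merge[OF this] show ?thesis unfolding x' by (rule exI)
  next
    case False
    then have "y = None \<and> (\<exists>i<n. x' = {({1..n}, i)})"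
      using all_blocks_kept[OF le[unfolded x'] neq[unfolded x'] n] by metis
    then obtain i where "y = None" "i < n" "x' = {({1..n}, i)}" by (elim exE conjE)
    then show ?thesis unfolding x' using least_cover.top by metis
  qed
qed

lemma least_merge_le:
  assumes "(Some x, y) \<in> wparts_hat_le n" "least_merge n x y A w B v u C z"
  shows "(Some z, y) \<in> wparts_hat_le n"
proof -
  have "\<exists>C\<in>blocks n y. A \<union> B \<subseteq> C \<and> admissible x y C u"
    using conjI[OF least_mergeD(3,4)[OF assms(2)]] least_mergeD(2)[OF assms(2)] by (rule bexI)
  from iffD2[OF merges_hat_le_iff[OF assms(1) least_mergeD(1)[OF assms(2)]] this] show ?thesis .
qed

section \<open>Covering relations\<close>

lemma not_merges_singleton: "\<not> merges {(D, s)} A w B v u z"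
proof
  assume m: "merges {(D, s)} A w B v u z"
  note m' = m[unfolded merges_def]
  from m' have "(A, w) \<in> {(D, s)}" by (elim conjE)
  moreover from m' have "(B, v) \<in> {(D, s)}" by (elim conjE)
  moreover from m' have "Min A < Min B" by (elim conjE)
  ultimately show False by simp
qed

text \<open>For \<open>y'\<close> strictly between, the least merge of \<open>x\<close> towards
  \<open>y'\<close> would lie below \<open>z\<close>, hence equal \<open>z\<close> by
  \<open>merges_unique\<close>, and \<open>y'\<close> would collapse to \<open>z\<close>.\<close>

lemma merges_covers:
  assumes x: "x \<in> wparts n" and m: "merges x A w B v u z" and n: "n \<ge> 1"
  shows "(Some x, Some z) \<in> covers (wparts_hat_le n)"
proof -
  interpret M: merge n x A w B v u z using x m by unfold_locales
  have "False" if y: "(Some x, y) \<in> strict (wparts_hat_le n)" "(y, Some z) \<in> strict (wparts_hat_le n)" for y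
  proof -
    obtain y' where y': "y = Some y'" using y by (cases y) (auto simp: strict_iff)
    then have le: "(x, y') \<in> wparts_le n" "(y', z) \<in> wparts_le n" and neq: "x \<noteq> y'" "y' \<noteq> z"
      using y by (auto simp: strict_iff)
    have leS: "(Some x, Some y') \<in> wparts_hat_le n" using le by simp
    moreover have "Some x \<noteq> Some y'" using neq by simp
    ultimately obtain z'' where "least_cover n (Some x) (Some y') z''"
      using least_cover_ex n by blast
    then obtain A' w' B' v' u' C z' where g: "least_merge n x (Some y') A' w' B' v' u' C z'"
      by (cases rule: least_coverE) simp_all
    have z'y: "(z', y') \<in> wparts_le n" using least_merge_le[OF leS g] by simp
    have "z' = z"
      using merges_unique[OF x m least_mergeD(1)[OF g] wparts_le_trans[OF z'y le(2)]] by simp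
    then show False using wparts_le_antisym[OF le(2)] z'y neq by simp
  qed
  moreover have "(Some x, Some z) \<in> wparts_hat_le n" "Some x \<noteq> Some z"
    using M.le_z M.z_neq by auto
  ultimately show ?thesis by (intro coversI)
qed

text \<open>An element strictly between would be a weighted partition, and the least step towards it
  would have to merge two blocks of a one-block partition.\<close>

lemma singleton_covers:
  assumes x: "{({1..n}, i)} \<in> wparts n" and n: "n \<ge> 1"
  shows "(Some {({1..n}, i)}, None) \<in> covers (wparts_hat_le n)"
proof -
  let ?x = "{({1..n}, i)}"
  have False if y: "(Some ?x, y) \<in> strict (wparts_hat_le n)" "(y, None) \<in> strict (wparts_hat_le n)" for y
  proof -
    obtain y' where y': "y = Some y'" using y by (cases y) (auto simp: strict_iff)
    have le: "(Some ?x, y) \<in> wparts_hat_le n" "Some ?x \<noteq> y" using y by (auto simp: strict_iff)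
    then obtain z where "least_cover n (Some ?x) y z" using least_cover_ex n by blast
    then show False
    proof (cases rule: least_coverE)
      case (merge x' A w B v u C z')
      from least_mergeD(1)[OF merge(3)] merge(1) show False
        using not_merges_singleton by (metis option.inject)
    next
      case top
      then show False using y' by simp
    qed
  qed
  moreover have "(Some ?x, None) \<in> wparts_hat_le n" "Some ?x \<noteq> None"
    using x by simp_all
  ultimately show ?thesis by (intro coversI)
qed

lemma least_cover_covers:
  assumes g: "least_cover n x y z" and le: "(x, y) \<in> wparts_hat_le n" and n: "n \<ge> 1"
  shows "(x, z) \<in> covers (wparts_hat_le n)" "(z, y) \<in> wparts_hat_le n"
proof -
  have "(x, z) \<in> covers (wparts_hat_le n) \<and> (z, y) \<in> wparts_hat_le n"
    using g
  proof (cases rule: least_coverE)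
    case (merge x' A w B v u C z')
    then have le': "(Some x', y) \<in> wparts_hat_le n" using le by simp
    show ?thesis
      using merges_covers[OF wparts_hat_leD[OF le'] least_mergeD(1)[OF merge(3)] n]
        least_merge_le[OF le' merge(3)] merge(1,2) by simp
  next
    case (top i)
    then show ?thesis using singleton_covers[of n i] le n by simp
  qed
  then show "(x, z) \<in> covers (wparts_hat_le n)" "(z, y) \<in> wparts_hat_le n" by auto
qed

text \<open>The least step from \<open>x\<close> towards \<open>z\<close> stays below
  \<open>z\<close>, so for a cover it ends at \<open>z\<close>. Thus all covers are classified by
  the shape of \<open>least_cover\<close>.\<close>

lemma covers_cases:
  assumes c: "(x, z) \<in> covers (wparts_hat_le n)" and n: "n \<ge> 1"
  obtains (merge) x' A w B v u z' where "x = Some x'" "z = Some z'" "x' \<in> wparts n" "merges x' A w B v u z'"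
  | (top) i where "i < n" "x = Some {({1..n}, i)}" "z = None"
proof -
  note le = coversD[OF c]
  obtain z'' where g: "least_cover n x z z''" using least_cover_ex[OF le n] by blast
  have "z'' = z"
  proof (rule ccontr)
    assume neq: "z'' \<noteq> z"
    have "(x, z'') \<in> strict (wparts_hat_le n)"
      using coversD[OF least_cover_covers(1)[OF g le(1) n]] by (simp add: strict_iff)
    moreover have "(z'', z) \<in> strict (wparts_hat_le n)"
      using least_cover_covers(2)[OF g le(1) n] neq by (simp add: strict_iff)
    ultimately show False using c unfolding covers_def by blast
  qed
  with g have "least_cover n x z z" by simp
  then show thesis
  proof (cases rule: least_coverE)
    case 1: (merge x' A w B v u C z')
    have "x' \<in> wparts n" using wparts_hat_leD[OF le(1)[unfolded 1(1)]] .
    from merge[OF 1(1,2) this least_mergeD(1)[OF 1(3)]] show thesis .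
  next
    case (top i)
    then show thesis using that(2) by simp
  qed
qed

lemma wlabel_Lambda:
  assumes "(x, z) \<in> covers (wparts_hat_le n)" "n \<ge> 1"
  shows "wlabel n x z \<in> Lambda n"
  using assms
proof (cases rule: covers_cases)
  case (merge x' A w B v u z')
  interpret M: merge n x' A w B v u z' using merge(3,4) by unfold_locales
  have "Min A \<in> {1..n}" "Min B \<in> {1..n}"
    using subsetD[OF wpartsD(2)[OF M.x M.A] wpartsD(5)[OF M.x M.A]]
      subsetD[OF wpartsD(2)[OF M.x M.B] wpartsD(5)[OF M.x M.B]] by blast+
  then show ?thesis
    using wlabel_merges[OF merge(3,4)] merge(1,2) M.Min_less M.u by (auto simp: Lambda_iff)
next
  case (top i)
  then show ?thesis using assms(2) by (auto simp: Lambda_iff)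
qed

section \<open>Comparing labels with the least label\<close>

lemma merge_block_notin:
  assumes le: "(Some x, y) \<in> wparts_hat_le n" and m: "merges x A w B v u z"
    and C: "C \<in> blocks n y" "A \<union> B \<subseteq> C"
  shows "A \<notin> blocks n y" "B \<notin> blocks n y"
proof -
  interpret M: merge n x A w B v u z using wparts_hat_leD[OF le] m by unfold_locales
  show "A \<notin> blocks n y" by (rule blocks_notin[OF le M.A M.B M.neq C(1)]) (use C(2) in simp_all)
  show "B \<notin> blocks n y"
    by (rule blocks_notin[OF le M.B M.A M.neq[symmetric] C(1)]) (use C(2) in simp_all)
qed

text \<open>If the first blocks have equal minima, they are equal and lie in the same
  \<open>C\<close>; then \<open>B\<close> competes with \<open>B0\<close>, and \<open>u\<close> with
  \<open>u0\<close>, under the same constraints.\<close>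

lemma least_merge_compare:
  assumes le: "(Some x, y) \<in> wparts_hat_le n" and g: "least_merge n x y A0 w0 B0 v0 u0 C0 z0"
    and m: "merges x A w B v u z" and C: "C \<in> blocks n y" "A \<union> B \<subseteq> C" "admissible x y C u"
  shows "Min A0 < Min A \<or> A = A0 \<and> w = w0 \<and> C = C0 \<and> (Min B0 < Min B \<or> B = B0 \<and> v = v0) \<and> u0 \<le> u"
proof (cases "Min A0 < Min A")
  case False
  have x: "x \<in> wparts n" using wparts_hat_leD[OF le] .
  note g = least_mergeD[OF g]
  interpret M0: merge n x A0 w0 B0 v0 u0 z0 using x g(1) by unfold_locales
  interpret M: merge n x A w B v u z using x m by unfold_locales
  have "Min A0 \<le> Min A" using g(5)[OF M.A merge_block_notin(1)[OF le m C(1,2)]] .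
  then have mA: "Min A = Min A0" using False by simp
  note A = wparts_Min_eq[OF x M.A M0.A mA]
  have mem: "Min A0 \<in> A0" using wpartsD(5)[OF x M0.A] .
  have "Min A0 \<in> C" "Min A0 \<in> C0" using mem C(2) g(3) A(1) by blast+
  then have CC: "C = C0" by (rule blocks_eq[OF le C(1) g(2)])
  have "B \<subseteq> C0" using C(2) CC by blast
  moreover have "B \<noteq> A0" using M.neq A(1) by simp
  ultimately have "Min B0 \<le> Min B" using g(6)[OF M.B] by simp
  moreover have "B = B0 \<and> v = v0" if "Min B = Min B0"
    using wparts_Min_eq[OF x M.B M0.B that] by (rule conjI)
  ultimately have B: "Min B0 < Min B \<or> B = B0 \<and> v = v0" by linarith
  \<comment> \<open>Admissibility depends on \<open>C\<close> and not on the merged pair, so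
    \<open>u = 0\<close> makes 0 admissible for the least merge too.\<close>
  have "u0 \<le> u"
  proof (cases "u = 0")
    case True
    then have "admissible x y C0 0" using C(3) CC by simp
    then show ?thesis using g(7) by simp
  next
    case False
    then show ?thesis using M0.u by simp
  qed
  then show ?thesis using A CC B by simp
qed simp

lemma merges_not_top:
  assumes "merges x A w B v u z"
  shows "\<not> least_cover n (Some x) y None"
proof
  assume "least_cover n (Some x) y None"
  then show False
  proof (cases rule: least_coverE)
    case (top i)
    then show False using assms not_merges_singleton by (metis option.inject)
  qed simp
qed

lemma least_cover_first:
  assumes g: "least_cover n x y z" and le: "(x, y) \<in> wparts_hat_le n"
    and c: "(x, z') \<in> covers (wparts_hat_le n)" and z'y: "(z', y) \<in> wparts_hat_le n"
    and neq: "z' \<noteq> z" and n: "n \<ge> 1"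
  shows "(wlabel n x z, wlabel n x z') \<in> strict (Lambda_le n)"
  using c n
proof (cases rule: covers_cases)
  case c: (merge x1 A w B v u z1)
  have le1: "(Some x1, y) \<in> wparts_hat_le n" using le c(1) by simp
  show ?thesis
    using g
  proof (cases rule: least_coverE)
    case g: (merge x2 A0 w0 B0 v0 u0 C0 z0)
    have g': "least_merge n x1 y A0 w0 B0 v0 u0 C0 z0" using g c(1) by simp
    note g0 = least_mergeD(1)[OF g']
    have "(Some z1, y) \<in> wparts_hat_le n" using z'y c(2) by simp
    then obtain C where "C \<in> blocks n y" "A \<union> B \<subseteq> C" "admissible x1 y C u"
      using merges_hat_le_iff[OF le1 c(4)] by blast
    note cmp = least_merge_compare[OF le1 g' c(4) this]
    have labs: "wlabel n x z = (Min A0, Min B0, u0)" "wlabel n x z' = (Min A, Min B, u)"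
      using wlabel_merges[OF c(3,4)] wlabel_merges[OF c(3) g0] c(1,2) g(2) by simp_all
    have "\<not> (A = A0 \<and> w = w0 \<and> B = B0 \<and> v = v0 \<and> u = u0)"
    proof
      assume "A = A0 \<and> w = w0 \<and> B = B0 \<and> v = v0 \<and> u = u0"
      then have "z1 = z0" using c(4) g0 by (simp add: merges_def)
      then show False using neq c(2) g(2) by simp
    qed
    then have less: "Min A0 < Min A \<or> Min A0 = Min A \<and> Min B0 \<le> Min B \<and> u0 \<le> u \<and> (Min B0 < Min B \<or> u0 \<noteq> u)"
      using cmp by (elim disjE conjE) simp_all
    moreover have "(x, z) \<in> covers (wparts_hat_le n)" 
      using least_cover_covers(1)[OF assms(1) le n] .
    then have "wlabel n x z \<in> Lambda n" "wlabel n x z' \<in> Lambda n"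
      using wlabel_Lambda assms(3) n by blast+
    then show ?thesis unfolding labs using less by (rule strict_Lambda_leI)
  next
    case (top i)
    then show ?thesis using merges_not_top[OF c(4)] g c(1) by simp
  qed
next
  case (top i)
  then have "y = None" using z'y by (cases y) simp_all
  from g show ?thesis
  proof (cases rule: least_coverE)
    case (merge x2 A0 w0 B0 v0 u0 C0 z0)
    then show ?thesis
      using top(2) least_mergeD(1)[OF merge(3)] not_merges_singleton by (metis option.inject)
  next
    case (top i)
    then show ?thesis using \<open>z' = None\<close> neq by simp
  qed
qed

text \<open>Effect of spending increment 1, which removes the smallest available weight. The first
  claim shows that the least merges never use 1 before 0 inside \<open>C\<close>. The other two
  concern a chain that uses 1 although 0 was possible: a later 0 stays admissible, and if
  \<open>A \<union> B\<close> is already a full block of \<open>y\<close>, then \<open>y\<close> is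
  the adjoined maximum, as the block of a weighted partition has just one weight.\<close>

lemma admissible_merge:
  assumes le: "(Some x, y) \<in> wparts_hat_le n" and m: "merges x A w B v 1 z" and C: "A \<union> B \<subseteq> C"
  shows "admissible z y C 0 \<Longrightarrow> admissible x y C 0"
    and "admissible x y C 0 \<Longrightarrow> admissible x y C 1 \<Longrightarrow> admissible z y C 0"
    and "admissible x y (A \<union> B) 0 \<Longrightarrow> admissible x y (A \<union> B) 1 \<Longrightarrow> y = None"
proof -
  interpret M: merge n x A w B v 1 z using wparts_hat_leD[OF le] m by unfold_locales
  have lo: "lo z C = lo x C + 1" and hi: "hi z C = hi x C"
    using M.lo_merge[OF C] M.hi_merge[OF C] by simp_all
  have eq: "s = t" if "(D, s) \<in> y'" "(D, t) \<in> y'" "y = Some y'" for D s t y'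
  proof -
    have "y' \<in> wparts n" using le that(3) wparts_leD(2) by simp
    from wparts_weight_eq[OF this that(1,2)] show ?thesis .
  qed
  show "admissible x y C 0" if "admissible z y C 0"
    using that by (cases y) (auto simp: lo hi)
  show "admissible z y C 0" if a: "admissible x y C 0" "admissible x y C 1"
  proof (cases y)
    case (Some y')
    obtain s where s: "(C, s) \<in> y'" "s + 2 \<le> hi x C"
      using a(1) unfolding Some admissible_simps by auto
    obtain t where t: "(C, t) \<in> y'" "lo x C + 1 \<le> t"
      using a(2) unfolding Some admissible_simps by auto
    from eq[OF s(1) t(1) Some] s t lo hi Some show ?thesis by auto
  qed simp
  show "y = None" if a: "admissible x y (A \<union> B) 0" "admissible x y (A \<union> B) 1"
  proof (cases y)
    case (Some y')
    obtain s where s: "(A \<union> B, s) \<in> y'" "s + 2 \<le> hi x (A \<union> B)"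
      using a(1) unfolding Some admissible_simps by auto
    obtain t where t: "(A \<union> B, t) \<in> y'" "lo x (A \<union> B) + 1 \<le> t"
      using a(2) unfolding Some admissible_simps by auto
    from eq[OF s(1) t(1) Some] s t M.lo_union M.hi_union show ?thesis by simp
  qed
qed

text \<open>The next least step either continues with \<open>A \<union> B\<close>, whose minimum is
  still that of \<open>A\<close>, or starts at an old block with a larger minimum, or goes to the
  adjoined maximum.\<close>

lemma least_merge_increasing:
  assumes le: "(Some x, y) \<in> wparts_hat_le n" and g: "least_merge n x y A w B v u C z"
    and g': "least_cover n (Some z) y z'" and n: "n \<ge> 1"
  shows "(wlabel n (Some x) (Some z), wlabel n (Some z) z') \<in> strict (Lambda_le n)"
proof -
  have x: "x \<in> wparts n" using wparts_hat_leD[OF le] .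
  note gD = least_mergeD[OF g]
  interpret M: merge n x A w B v u z using x gD(1) by unfold_locales
  note zy = least_merge_le[OF le g]
  have lab: "wlabel n (Some x) (Some z) = (Min A, Min B, u)" using wlabel_merges[OF x gD(1)] .
  have L: "wlabel n (Some x) (Some z) \<in> Lambda n" "wlabel n (Some z) z' \<in> Lambda n"
    using wlabel_Lambda merges_covers[OF x gD(1) n] least_cover_covers(1)[OF g' zy n] n by blast+
  from g' show ?thesis
  proof (cases rule: least_coverE)
    case h: (merge z2 A1 w1 B1 v1 u1 C1 z1)
    have h': "least_merge n z y A1 w1 B1 v1 u1 C1 z1" using h by simp
    note hD = least_mergeD[OF h']
    interpret N: merge n z A1 w1 B1 v1 u1 z1 using M.z_wparts hD(1) by unfold_locales
    have lab': "wlabel n (Some z) z' = (Min A1, Min B1, u1)"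
      using wlabel_merges[OF M.z_wparts hD(1)] h(2) by simp
    have A1: "A1 \<notin> blocks n y" using merge_block_notin(1)[OF zy hD(1-3)] .
    have "Min A < Min A1 \<or> Min A = Min A1 \<and> Min B < Min B1 \<and> u \<le> u1"
    proof (cases "A1 = A \<union> B")
      case True
      have C1: "C1 = C"
      proof -
        have "Min A \<in> A" using wpartsD(5)[OF x M.A] .
        then have "Min A \<in> C1" "Min A \<in> C" using hD(3) gD(3) True by blast+
        then show ?thesis by (rule blocks_eq[OF zy hD(2) gD(2)])
      qed
      \<comment> \<open>The new block of \<open>z\<close> is taken by \<open>A1\<close>, so
        \<open>B1\<close> is an old block and was a candidate when \<open>B\<close> was
        chosen.\<close>
      have B1: "(B1, v1) \<in> x" "B1 \<noteq> A" "B1 \<noteq> B"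
        using N.B N.neq M.mem_iff True by metis+
      have "Min B \<le> Min B1" using gD(6)[OF B1(1) _ B1(2)] hD(3) C1 by simp
      moreover have "Min B \<noteq> Min B1" using wparts_Min_eq(1)[OF x M.B B1(1)] B1(3) by metis
      moreover have "u \<le> u1"
      \<comment> \<open>If 0 is admissible after increment 1, it was admissible before, and the
        least merge would have used it.\<close>
      proof (cases "u = 1 \<and> u1 = 0")
        case True
        then have "admissible z y C 0" using hD(4) C1 by simp
        then have "admissible x y C 0" using admissible_merge(1)[OF le _ gD(3)] gD(1) True by metis
        then show ?thesis using gD(7) by simp
      next
        case False
        then show ?thesis using M.u N.u by linarith
      qed
      ultimately show ?thesis using True M.Min_union by simp
    next
      case False
      then have A1x: "(A1, w1) \<in> x" "A1 \<noteq> A" using N.A M.mem_iff by metis+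
      have "Min A \<le> Min A1" using gD(5)[OF A1x(1) A1] .
      moreover have "Min A \<noteq> Min A1" using wparts_Min_eq(1)[OF x M.A A1x(1)] A1x(2) by metis
      ultimately show ?thesis by simp
    qed
    then show ?thesis using L unfolding lab lab' strict_iff Lambda_le_iff by auto
  next
    case (top i)
    have lab': "wlabel n (Some z) z' = (1, n + 1, 0)" using top by auto
    \<comment> \<open>Below the adjoined maximum increment 0 is always admissible, so the exponent 0
      of the last label is matched. It remains to see that the first entry is 1.\<close>
    have "u = 0" using gD(7) top(3) by simp
    moreover have "Min A = 1"
    proof -
      have C: "C = {1..n}" using gD(2) top(3) by simp
      have one: "1 \<in> {1..n}" using n by simp
      obtain D s where D: "(D, s) \<in> x" "1 \<in> D" using wparts_ex[OF x one] by blast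
      have "Min D \<le> 1" using wpartsD(3)[OF x D(1)] D(2) by (rule Min_le)
      moreover have "Min A \<le> Min D"
      proof (cases "D = {1..n}")
        case True
        then have "A \<subseteq> D" using wpartsD(2)[OF x M.A] by simp
        then have "A = D" by (rule wparts_subset_eq(1)[OF x M.A D(1)])
        then show ?thesis by simp
      next
        case False
        then have "D \<notin> blocks n y" using top(3) by simp
        then show ?thesis by (rule gD(5)[OF D(1)])
      qed
      moreover have "1 \<le> Min A" using L(1) unfolding lab Lambda_iff by simp
      ultimately show ?thesis by simp
    qed
    moreover have "Min B < n + 1"
      using subsetD[OF wpartsD(2)[OF x M.B] wpartsD(5)[OF x M.B]] by simp
    ultimately show ?thesis using L unfolding lab lab' strict_iff Lambda_le_iff by auto
  qed
qed

text \<open>A merge other than the least one leaves something smaller undone: a block with smaller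
  minimum, a partner with smaller minimum, or an increment 0. The least step after it makes up for
  this, or goes to the adjoined maximum with exponent 0, and so the labels fail to increase.\<close>

lemma least_cover_unique_increasing:
  assumes le: "(Some x, y) \<in> wparts_hat_le n" and g: "least_merge n x y A0 w0 B0 v0 u0 C0 z0"
    and m: "merges x A w B v u z" and zy: "(Some z, y) \<in> wparts_hat_le n"
    and g': "least_cover n (Some z) y z'" and n: "n \<ge> 1"
    and incr: "(wlabel n (Some x) (Some z), wlabel n (Some z) z') \<in> strict (Lambda_le n)"
  shows "z = z0"
proof (rule ccontr)
  assume neq: "z \<noteq> z0"
  have x: "x \<in> wparts n" using wparts_hat_leD[OF le] .
  note gD = least_mergeD[OF g]
  interpret M0: merge n x A0 w0 B0 v0 u0 z0 using x gD(1) by unfold_locales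
  interpret M: merge n x A w B v u z using x m by unfold_locales
  obtain C where C: "C \<in> blocks n y" "A \<union> B \<subseteq> C" "admissible x y C u"
    using merges_hat_le_iff[OF le m] zy by blast
  note cmp = least_merge_compare[OF le g m C]
  have lab: "wlabel n (Some x) (Some z) = (Min A, Min B, u)" using wlabel_merges[OF x m] .
  \<comment> \<open>The next label starts with the least minimum of an unfinished block of
    \<open>z\<close>, so an increase bounds all these minima from below by
    \<open>Min A\<close>.\<close>
  have least: "Min A \<le> Min D" if D: "(D, s) \<in> z" "D \<notin> blocks n y" for D s
  proof -
    from g' show ?thesis
    proof (cases rule: least_coverE)
      case (merge z2 A1 w1 B1 v1 u1 C1 z1)
      then have h: "least_merge n z y A1 w1 B1 v1 u1 C1 z1" by simp
      have "wlabel n (Some z) z' = (Min A1, Min B1, u1)"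
        using wlabel_merges[OF M.z_wparts least_mergeD(1)[OF h]] merge(2) by simp
      then have "Min A \<le> Min A1" using incr unfolding lab strict_iff by (auto simp: Lambda_le_iff)
      also have "Min A1 \<le> Min D" using least_mergeD(5)[OF h D] .
      finally show ?thesis .
    next
      case (top i)
      then show ?thesis using D by simp
    qed
  qed
  have A0n: "A0 \<notin> blocks n y" "B0 \<notin> blocks n y" using merge_block_notin[OF le gD(1-3)] .
  have "\<not> Min A0 < Min A"
  proof
    assume lt: "Min A0 < Min A"
    then have "A0 \<noteq> A" "A0 \<noteq> B" using M.Min_less by auto
    then have "(A0, w0) \<in> z" using M0.A M.mem_iff by metis
    from least[OF this A0n(1)] lt show False by simp
  qed
  with cmp have A: "A = A0" "w = w0" "C = C0" and B: "Min B0 < Min B \<or> B = B0 \<and> v = v0" and u: "u0 \<le> u"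
    by (metis (no_types))+
  \<comment> \<open>An unfinished \<open>A \<union> B\<close> has minimum \<open>Min A\<close>, the
    smallest one allowed, so the next step must extend it; the increase then compares second entries
    and exponents.\<close>
  have next_label: "\<exists>A1 w1 B1 v1 u1 z1. least_merge n z y A1 w1 B1 v1 u1 C z1 \<and>
      A1 = A \<union> B \<and> Min B \<le> Min B1 \<and> u \<le> u1"
    if AB: "A \<union> B \<notin> blocks n y"
  proof -
    have ABz: "(A \<union> B, u + w + v) \<in> z" using M.mem_iff by metis
    from g' show ?thesis
    proof (cases rule: least_coverE)
      case (merge z2 A1 w1 B1 v1 u1 C1 z1)
      then have h: "least_merge n z y A1 w1 B1 v1 u1 C1 z1" by simp
      note hD = least_mergeD[OF h]
      interpret N: merge n z A1 w1 B1 v1 u1 z1 using M.z_wparts hD(1) by unfold_locales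
      have "wlabel n (Some z) z' = (Min A1, Min B1, u1)"
        using wlabel_merges[OF M.z_wparts hD(1)] merge(2) by simp
      then have lt: "Min A < Min A1 \<or> Min A = Min A1 \<and> Min B \<le> Min B1 \<and> u \<le> u1"
        using incr unfolding lab strict_iff by (auto simp: Lambda_le_iff)
      have "Min A1 \<le> Min (A \<union> B)" using hD(5)[OF ABz AB] .
      then have eq: "Min A1 = Min (A \<union> B)" using lt M.Min_union by linarith
      have A1: "A1 = A \<union> B" using wparts_Min_eq(1)[OF M.z_wparts N.A ABz eq] .
      have "Min A \<in> A" using wpartsD(5)[OF x M.A] .
      then have "Min A \<in> C1" "Min A \<in> C" using hD(3) C(2) A1 by blast+
      then have "C1 = C" by (rule blocks_eq[OF zy hD(2) C(1)])
      then have "least_merge n z y A1 w1 B1 v1 u1 C z1" using h by simp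
      moreover have "Min B \<le> Min B1 \<and> u \<le> u1" using lt eq M.Min_union by linarith
      ultimately show ?thesis using A1 by blast
    next
      case (top i)
      then show ?thesis using ABz AB by simp
    qed
  qed
  show False
  proof (cases "Min B0 < Min B")
    case True
    then have ne: "B0 \<noteq> B" "B0 \<noteq> A" using A(1) M0.neq by auto
    then have B0: "(B0, v0) \<in> z" using M0.B M.mem_iff by metis
    \<comment> \<open>The skipped block \<open>B0\<close> still lies in \<open>C\<close>, so
      \<open>C\<close> is not yet complete and \<open>B0\<close> competes for the next
      merge.\<close>
    have "A \<union> B \<noteq> C"
    proof
      assume "A \<union> B = C"
      then have "(C, u + w + v) \<in> z" using M.mem_iff by metis
      moreover have "B0 \<subseteq> C" using gD(3) A(3) by simp
      ultimately have "B0 = C" using wparts_subset_eq(1)[OF M.z_wparts B0] by metis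
      then show False using C(1) A0n(2) by simp
    qed
    moreover have "A \<union> B = C" if "A \<union> B \<in> blocks n y"
    proof -
      have mA: "Min A \<in> A" using wpartsD(5)[OF x M.A] .
      then have "Min A \<in> A \<union> B" "Min A \<in> C" using C(2) by blast+
      then show ?thesis by (rule blocks_eq[OF le that C(1)])
    qed
    ultimately have AB: "A \<union> B \<notin> blocks n y" by blast
    obtain A1 w1 B1 v1 u1 z1 where h: "least_merge n z y A1 w1 B1 v1 u1 C z1"
      and A1: "A1 = A \<union> B" and B1: "Min B \<le> Min B1"
      using next_label[OF AB] by (elim exE conjE)
    have "B0 \<noteq> A1"
    proof
      assume "B0 = A1"
      then have "Min B0 = Min A0" using A1 M.Min_union A(1) by simp
      then show False using M0.Min_less by simp
    qed
    moreover have "B0 \<subseteq> C" using gD(3) A(3) by simp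
    ultimately have "Min B1 \<le> Min B0" using least_mergeD(6)[OF h B0] by simp
    then show False using True B1 by simp
  next
    case False
    then have BB: "B = B0" "v = v0" using B by auto
    have "u \<noteq> u0"
    proof
      assume "u = u0"
      then have "z = z0" using M.z M0.z A BB by simp
      with neq show False ..
    qed
    \<comment> \<open>Only the exponent differs: 1 was used although 0 was admissible.\<close>
    then have u01: "u = 1" "u0 = 0" using u M.u by auto
    have adm: "admissible x y C 0" "admissible x y C 1" using gD(4) C(3) A(3) u01 by simp_all
    have m1: "merges x A w B v 1 z" using m u01(1) by simp
    show False
    proof (cases "A \<union> B \<in> blocks n y")
      case True
      have mA: "Min A \<in> A" using wpartsD(5)[OF x M.A] .
      then have "Min A \<in> A \<union> B" "Min A \<in> C" using C(2) by blast+
      then have "A \<union> B = C" by (rule blocks_eq[OF le True C(1)])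
      then have y: "y = None" using admissible_merge(3)[OF le m1 C(2)] adm by simp
      then have full: "A \<union> B = {1..n}" using True by simp
      from g' show False
      proof (cases rule: least_coverE)
        case (merge z2 A1 w1 B1 v1 u1 C1 z1)
        then have h: "least_merge n z y A1 w1 B1 v1 u1 C1 z1" by simp
        note hD = least_mergeD[OF h]
        interpret N: merge n z A1 w1 B1 v1 u1 z1 using M.z_wparts hD(1) by unfold_locales
        have ABz: "(A \<union> B, u + w + v) \<in> z" using M.mem_iff by metis
        have "A1 \<subseteq> A \<union> B" "B1 \<subseteq> A \<union> B"
          using wpartsD(2)[OF M.z_wparts N.A] wpartsD(2)[OF M.z_wparts N.B] unfolding full .
        then have "A1 = A \<union> B" "B1 = A \<union> B"
          using wparts_subset_eq(1)[OF M.z_wparts N.A ABz] wparts_subset_eq(1)[OF M.z_wparts N.B ABz]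
          by (metis (no_types))+
        then show False using N.neq by simp
      next
        \<comment> \<open>The exponent drops from 1 to 0 while both first entries are 1, so these
          labels do not increase.\<close>
        case (top i)
        then have "wlabel n (Some z) z' = (1, n + 1, 0)" by auto
        moreover have "Min (A \<union> B) = 1" unfolding full using n by (intro Min_eqI) auto
        then have "Min A = 1" using M.Min_union by simp
        ultimately show False using incr u01 unfolding lab strict_iff by (auto simp: Lambda_le_iff)
      qed
    next
      case AB: False
      obtain A1 w1 B1 v1 u1 z1 where h: "least_merge n z y A1 w1 B1 v1 u1 C z1" and "u \<le> u1"
        using next_label[OF AB] by (elim exE conjE)
      moreover have "admissible z y C 0" using admissible_merge(2)[OF le m1 C(2) adm] .
      ultimately show False using least_mergeD(7)[OF h] u01 by simp
    qed
  qed
qed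

theorem theorem3p2:
  fixes n :: nat
  assumes "n \<ge> 1"
  shows "EL_labeling (wparts_hat n) (wparts_hat_le n) (Lambda n) (Lambda_le n) (wlabel n)"
\<comment> \<open>The rank is the number of blocks plus one, with 0 at the adjoined maximum, so the
  last step lowers it as every merge does.\<close>
proof (rule EL_labelingI[where G = "least_cover n" and \<mu> = "\<lambda>x. case x of None \<Rightarrow> 0 | Some x' \<Rightarrow> Suc (card x')"])
  show "edge_labeling (wparts_hat n) (wparts_hat_le n) (Lambda n) (Lambda_le n) (wlabel n)"
    unfolding edge_labeling_def
    using bounded_poset_wparts_hat partial_order_Lambda wlabel_Lambda assms by blast
next
  fix x z assume "(x, z) \<in> covers (wparts_hat_le n)"
  then show "(case z of None \<Rightarrow> 0 | Some z' \<Rightarrow> Suc (card z')) < (case x of None \<Rightarrow> 0 | Some x' \<Rightarrow> Suc (card x'))"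
    using assms
  proof (cases rule: covers_cases)
    case (merge x' A w B v u z')
    then show ?thesis using merge.card_less[OF merge.intro[OF merge(3,4)]] by simp
  next
    case (top i)
    then show ?thesis by simp
  qed
next
  fix x y assume "(x, y) \<in> wparts_hat_le n" "x \<noteq> y"
  then show "\<exists>z. least_cover n x y z" using least_cover_ex assms by blast
next
  fix x y z assume "least_cover n x y z" "(x, y) \<in> wparts_hat_le n"
  then show "(x, z) \<in> covers (wparts_hat_le n) \<and> (z, y) \<in> wparts_hat_le n"
    using least_cover_covers assms by blast
next
  fix x y z z' assume "least_cover n x y z" "(x, y) \<in> wparts_hat_le n"
    "(x, z') \<in> covers (wparts_hat_le n)" "(z', y) \<in> wparts_hat_le n" "z' \<noteq> z"
  then show "(wlabel n x z, wlabel n x z') \<in> strict (Lambda_le n)"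
    using least_cover_first assms by blast
next
  fix x y z z' z'' assume g: "least_cover n x y z" and le: "(x, y) \<in> wparts_hat_le n"
    and c: "(x, z') \<in> covers (wparts_hat_le n)" and z'y: "(z', y) \<in> wparts_hat_le n"
    and g': "least_cover n z' y z''"
  obtain z1 where z1: "z' = Some z1" using g' by (cases rule: least_coverE) auto
  from c assms obtain x1 A w B v u where x1: "x = Some x1" and m: "merges x1 A w B v u z1"
    using z1 by (cases rule: covers_cases) auto
  have le1: "(Some x1, y) \<in> wparts_hat_le n" and zy1: "(Some z1, y) \<in> wparts_hat_le n"
    and g1: "least_cover n (Some z1) y z''"
    using le z'y g' x1 z1 by simp_all
  obtain A0 w0 B0 v0 u0 C0 z0 where z0: "z = Some z0" and h: "least_merge n x1 y A0 w0 B0 v0 u0 C0 z0"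
    using g
  proof (cases rule: least_coverE)
    case (merge x' A w B v u C z')
    then show thesis using that[of z' A w B v u C] x1 by simp
  next
    case (top i)
    then show thesis using merges_not_top[OF m] g x1 by simp
  qed
  show "(wlabel n x z', wlabel n z' z'') \<in> strict (Lambda_le n) \<longleftrightarrow> z' = z"
  proof
    assume "(wlabel n x z', wlabel n z' z'') \<in> strict (Lambda_le n)"
    then have "z1 = z0"
      using least_cover_unique_increasing[OF le1 h m zy1 g1 assms] x1 z1 by simp
    then show "z' = z" using z0 z1 by simp
  next
    assume "z' = z"
    then have "z1 = z0" using z0 z1 by simp
    then show "(wlabel n x z', wlabel n z' z'') \<in> strict (Lambda_le n)"
      using least_merge_increasing[OF le1 h _ assms] g1 x1 z1 by simp
  qed
qed

end
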